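(* Let $G$ and $H$ be finite groups with $H$ acting on $G$ by automorphisms, written $(h,g)\mapsto{}^hg$. Let $R$ be either $\mathbb{Z}$ or a field of characteristic $p>0$ with $p$ dividing $|G|$. Let $g_1,\ldots,g_t\in G$ be representatives of the orbits of $H$ on $G$ and let $H_i=\{h\in H:{}^hg_i=g_i\}$. Then the map $$\widehat{\mathrm{H}}^*(H,RG)\longrightarrow\bigoplus_{i=1}^t\widehat{\mathrm{H}}^*(H_i,R),\qquad \zeta\mapsto\big(\pi_{g_i}^*(\mathrm{res}^H_{H_i}(\zeta))\big)_i,$$ is an isomorphism of graded $R$-modules. Its inverse sends $\alpha\in\widehat{\mathrm{H}}^*(H_i,R)$ to $\psi_i(\alpha)=\mathrm{cor}^H_{H_i}(\theta_{g_i}^*(\alpha))\in\widehat{\mathrm{H}}^*(H,RG)$.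
   Context: For a finite group $K$, a complete resolution of the trivial $RK$-module $R$ is an exact complex $\mathbb{P}=\{P_n\}_{n\in\mathbb{Z}}$ of finitely generated projective $RK$-modules such that $\mathrm{Hom}_{RK}(\mathbb{P},RK)$ is exact and there are a projective resolution $\mathbb{Q}\to R$ and a chain map $\mathbb{P}\to\mathbb{Q}$ that is bijective in degrees $\ge 0$ and $0$ in negative degrees. For a left $RK$-module $M$, Tate cohomology is $\widehat{\mathrm{H}}^n(K,M)=\mathrm{H}^n(\mathrm{Hom}_{RK}(\mathbb{P},M))$ for all $n\in\mathbb{Z}$, and $\widehat{\mathrm{H}}^*(K,M)=\bigoplus_{n\in\mathbb{Z}}\widehat{\mathrm{H}}^n(K,M)$. Here $R$ is the trivial module and $RG$ is an $RH$-module by linearly extending the action of $H$ on $G$. For subgroups $L\le K\le H$ and an $RH$-module $N$, computing with an $RH$-complete resolution $\mathbb{P}$ of $R$ (restricted to subgroups): $\mathrm{res}^K_L:\widehat{\mathrm{H}}^*(K,N)\to\widehat{\mathrm{H}}^*(L,N)$ is induced by the inclusion $\mathrm{Hom}_{RK}(\mathbb{P},N)\subset\mathrm{Hom}_{RL}(\mathbb{P},N)$; $\mathrm{cor}^K_L:\widehat{\mathrm{H}}^*(L,N)\to\widehat{\mathrm{H}}^*(K,N)$ is induced by $(\mathrm{cor}^K_Lf)(p)=\sum_{u}u f(u^{-1}p)$, with $u$ running over left coset representatives of $L$ in $K$. For $g\in G$ and a subgroup $V\subseteq\mathrm{Stab}_H(g)$, $\theta_g^*:\widehat{\mathrm{H}}^*(V,R)\to\widehat{\mathrm{H}}^*(V,RG)$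 and $\pi_g^*:\widehat{\mathrm{H}}^*(V,RG)\to\widehat{\mathrm{H}}^*(V,R)$ are induced by the $RV$-module homomorphisms $\theta_g:R\to RG$, $r\mapsto rg$, and $\pi_g:RG\to R$, $\sum_{a\in G}r_aa\mapsto r_g$. *)

theory Defs
  imports "HOL-Algebra.Algebra"
begin

subsection \<open>Left modules over a ring\<close>

text \<open>The locale \<open>module\<close> of the library is restricted to commutative scalars; group rings need the
  same axioms over an arbitrary ring. As in the library, a module is a ring record extended by a
  scalar multiplication whose fields \<open>mult\<close> and \<open>one\<close> carry no meaning.\<close>

locale left_module = A?: ring A + M?: abelian_group M
  for A :: "('a, 'e) ring_scheme" (structure) and M :: "('a, 'm) module" (structure) +
  assumes smult_closed: "\<lbrakk>a \<in> carrier A; x \<in> carrier M\<rbrakk> \<Longrightarrow> a \<odot>\<^bsub>M\<^esub> x \<in> carrier M"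
    and smult_l_distr: "\<lbrakk>a \<in> carrier A; b \<in> carrier A; x \<in> carrier M\<rbrakk> \<Longrightarrow>
      (a \<oplus> b) \<odot>\<^bsub>M\<^esub> x = a \<odot>\<^bsub>M\<^esub> x \<oplus>\<^bsub>M\<^esub> b \<odot>\<^bsub>M\<^esub> x"
    and smult_r_distr: "\<lbrakk>a \<in> carrier A; x \<in> carrier M; y \<in> carrier M\<rbrakk> \<Longrightarrow>
      a \<odot>\<^bsub>M\<^esub> (x \<oplus>\<^bsub>M\<^esub> y) = a \<odot>\<^bsub>M\<^esub> x \<oplus>\<^bsub>M\<^esub> a \<odot>\<^bsub>M\<^esub> y"
    and smult_assoc: "\<lbrakk>a \<in> carrier A; b \<in> carrier A; x \<in> carrier M\<rbrakk> \<Longrightarrow>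
      (a \<otimes> b) \<odot>\<^bsub>M\<^esub> x = a \<odot>\<^bsub>M\<^esub> (b \<odot>\<^bsub>M\<^esub> x)"
    and smult_one: "x \<in> carrier M \<Longrightarrow> \<one> \<odot>\<^bsub>M\<^esub> x = x"

definition lmod_hom :: "('a, 'e) ring_scheme \<Rightarrow> ('a, 'm) module \<Rightarrow> ('a, 'n) module \<Rightarrow> ('m \<Rightarrow> 'n) set"
  where "lmod_hom A M N = {f \<in> hom (add_monoid M) (add_monoid N).
    \<forall>a\<in>carrier A. \<forall>x\<in>carrier M. f (a \<odot>\<^bsub>M\<^esub> x) = a \<odot>\<^bsub>N\<^esub> f x}"

definition regular_module :: "('a, 'e) ring_scheme \<Rightarrow> ('a, 'a) module"
  where "regular_module A = \<lparr>carrier = carrier A, monoid.mult = monoid.mult A, monoid.one = \<one>\<^bsub>A\<^esub>,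
    ring.zero = \<zero>\<^bsub>A\<^esub>, ring.add = ring.add A, module.smult = monoid.mult A\<rparr>"

definition direct_sum :: "'i set \<Rightarrow> ('i \<Rightarrow> ('a, 'm) module) \<Rightarrow> ('a, 'i \<Rightarrow> 'm) module"
  where "direct_sum I M =
    \<lparr>carrier = {x \<in> \<Pi>\<^sub>E i\<in>I. carrier (M i). finite {i \<in> I. x i \<noteq> \<zero>\<^bsub>M i\<^esub>}},
     monoid.mult = undefined, monoid.one = undefined,
     ring.zero = (\<lambda>i\<in>I. \<zero>\<^bsub>M i\<^esub>), ring.add = (\<lambda>x y. \<lambda>i\<in>I. x i \<oplus>\<^bsub>M i\<^esub> y i),
     module.smult = (\<lambda>a x. \<lambda>i\<in>I. a \<odot>\<^bsub>M i\<^esub> x i)\<rparr>"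

definition quotient_module :: "('a, 'm) module \<Rightarrow> 'm set \<Rightarrow> ('a, 'm set) module"
  where "quotient_module M B =
    \<lparr>carrier = a_rcosets\<^bsub>M\<^esub> B, monoid.mult = undefined, monoid.one = undefined,
     ring.zero = B, ring.add = set_add M,
     module.smult = (\<lambda>a C. \<Union>x\<in>C. B +>\<^bsub>M\<^esub> (a \<odot>\<^bsub>M\<^esub> x))\<rparr>"

definition finitely_generated :: "('a, 'e) ring_scheme \<Rightarrow> ('a, 'm) module \<Rightarrow> bool"
  where "finitely_generated A M \<longleftrightarrow> (\<exists>S. finite S \<and> S \<subseteq> carrier M \<and>
    (\<forall>x\<in>carrier M. \<exists>c \<in> S \<rightarrow> carrier A. x = (\<Oplus>\<^bsub>M\<^esub>s\<in>S. c s \<odot>\<^bsub>M\<^esub> s)))"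

text \<open>A module is projective if it is a direct summand of a free module. Ranging over index sets
  of the type of its elements loses nothing: a projective module is a summand of the
  free module on its own carrier.\<close>

definition projective :: "('a, 'e) ring_scheme \<Rightarrow> ('a, 'm) module \<Rightarrow> bool"
  where "projective A M \<longleftrightarrow> (\<exists>(I :: 'm set).
    \<exists>s \<in> lmod_hom A M (direct_sum I (\<lambda>_. regular_module A)).
    \<exists>r \<in> lmod_hom A (direct_sum I (\<lambda>_. regular_module A)) M.
      \<forall>x\<in>carrier M. r (s x) = x)"

definition graded_iso ::
    "('a, 'e) ring_scheme \<Rightarrow> ('a, 'm) module \<Rightarrow> (int \<Rightarrow> 'm set) \<Rightarrow>
     ('a, 'n) module \<Rightarrow> (int \<Rightarrow> 'n set) \<Rightarrow> ('m \<Rightarrow> 'n) \<Rightarrow> bool"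
  where "graded_iso R M M' N N' f \<longleftrightarrow> module R M \<and> module R N \<and> f \<in> lmod_hom R M N \<and>
    bij_betw f (carrier M) (carrier N) \<and> (\<forall>n. f ` M' n = N' n)"

subsection \<open>Group rings\<close>

definition ring_char :: "('r, 'e) ring_scheme \<Rightarrow> nat"
  where "ring_char R = group.ord (add_monoid R) \<one>\<^bsub>R\<^esub>"

text \<open>Elements of the group ring of a finite group \<open>K\<close> are coefficient functions vanishing outside
  \<open>K\<close>. Thus the group ring of a subgroup is literally a subring, and a module over \<open>RH\<close>, left
  unchanged, is its own restriction to \<open>RL\<close> for every subgroup \<open>L\<close>.\<close>

definition group_ring :: "('r, 'e) ring_scheme \<Rightarrow> ('h, 'k) monoid_scheme \<Rightarrow> ('h \<Rightarrow> 'r) ring"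
  where "group_ring R K =
    \<lparr>carrier = {a. (\<forall>x\<in>carrier K. a x \<in> carrier R) \<and> (\<forall>x. x \<notin> carrier K \<longrightarrow> a x = \<zero>\<^bsub>R\<^esub>)},
     monoid.mult = (\<lambda>a b x. \<Oplus>\<^bsub>R\<^esub>w\<in>{(y, z). y \<in> carrier K \<and> z \<in> carrier K \<and> y \<otimes>\<^bsub>K\<^esub> z = x}.
       a (fst w) \<otimes>\<^bsub>R\<^esub> b (snd w)),
     monoid.one = (\<lambda>x. if x = \<one>\<^bsub>K\<^esub> then \<one>\<^bsub>R\<^esub> else \<zero>\<^bsub>R\<^esub>),
     ring.zero = (\<lambda>x. \<zero>\<^bsub>R\<^esub>),
     ring.add = (\<lambda>a b x. if x \<in> carrier K then a x \<oplus>\<^bsub>R\<^esub> b x else \<zero>\<^bsub>R\<^esub>)\<rparr>"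

text \<open>\<open>gr_single R g r\<close> is the element \<open>r g\<close>; as a function of \<open>r\<close> it is the map \<open>\<theta>\<^sub>g\<close>.\<close>

definition gr_single :: "('r, 'e) ring_scheme \<Rightarrow> 'g \<Rightarrow> 'r \<Rightarrow> 'g \<Rightarrow> 'r"
  where "gr_single R g r = (\<lambda>x. if x = g then r else \<zero>\<^bsub>R\<^esub>)"

definition gr_coeff :: "'g \<Rightarrow> ('g \<Rightarrow> 'r) \<Rightarrow> 'r"
  where "gr_coeff g a = a g"

definition trivial_module ::
    "('r, 'e) ring_scheme \<Rightarrow> ('h, 'k) monoid_scheme \<Rightarrow> ('h \<Rightarrow> 'r, 'r) module"
  where "trivial_module R H = \<lparr>carrier = carrier R, monoid.mult = monoid.mult R, monoid.one = \<one>\<^bsub>R\<^esub>,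
    ring.zero = \<zero>\<^bsub>R\<^esub>, ring.add = ring.add R, module.smult = (\<lambda>a r. \<Oplus>\<^bsub>R\<^esub>h\<in>carrier H. a h \<otimes>\<^bsub>R\<^esub> r)\<rparr>"

text \<open>The \<open>RH\<close>-module \<open>RG\<close>: the coefficient of \<open>x\<close> in
  \<open>(\<Sum>h. a\<^sub>h h) (\<Sum>g. m\<^sub>g g) = \<Sum>h g. a\<^sub>h m\<^sub>g (\<phi> h g)\<close>.\<close>

definition action_module ::
    "('r, 'e) ring_scheme \<Rightarrow> ('h, 'k) monoid_scheme \<Rightarrow> ('g, 'l) monoid_scheme \<Rightarrow>
     ('h \<Rightarrow> 'g \<Rightarrow> 'g) \<Rightarrow> ('h \<Rightarrow> 'r, 'g \<Rightarrow> 'r) module"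
  where "action_module R H G \<phi> =
    \<lparr>carrier = carrier (group_ring R G),
     monoid.mult = monoid.mult (group_ring R G), monoid.one = monoid.one (group_ring R G),
     ring.zero = ring.zero (group_ring R G), ring.add = ring.add (group_ring R G),
     module.smult = (\<lambda>a m x. \<Oplus>\<^bsub>R\<^esub>w\<in>{(h, g). h \<in> carrier H \<and> g \<in> carrier G \<and> \<phi> h g = x}.
       a (fst w) \<otimes>\<^bsub>R\<^esub> m (snd w))\<rparr>"

text \<open>\<open>Hom\<^sub>R\<^sub>K(M, N)\<close> as an \<open>R\<close>-module.\<close>

definition hom_module ::
    "('r, 'e) ring_scheme \<Rightarrow> ('h, 'k) monoid_scheme \<Rightarrow> ('h \<Rightarrow> 'r, 'm) module \<Rightarrow>
     ('h \<Rightarrow> 'r, 'n) module \<Rightarrow> ('r, 'm \<Rightarrow> 'n) module"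
  where "hom_module R K M N =
    \<lparr>carrier = lmod_hom (group_ring R K) M N \<inter> extensional (carrier M),
     monoid.mult = undefined, monoid.one = undefined,
     ring.zero = (\<lambda>p\<in>carrier M. \<zero>\<^bsub>N\<^esub>),
     ring.add = (\<lambda>f f'. \<lambda>p\<in>carrier M. f p \<oplus>\<^bsub>N\<^esub> f' p),
     module.smult = (\<lambda>r f. \<lambda>p\<in>carrier M. gr_single R \<one>\<^bsub>K\<^esub> r \<odot>\<^bsub>N\<^esub> f p)\<rparr>"

subsection \<open>Cohomology of \<open>Hom\<^sub>R\<^sub>K(P, M)\<close>\<close>

text \<open>The differential \<open>d n\<close> of a complex \<open>P\<close> goes from \<open>P n\<close> to \<open>P (n - 1)\<close>.\<close>

definition cocycles ::
    "('r, 'e) ring_scheme \<Rightarrow> ('h, 'k) monoid_scheme \<Rightarrow> (int \<Rightarrow> ('h \<Rightarrow> 'r, 'p) module) \<Rightarrow>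
     (int \<Rightarrow> 'p \<Rightarrow> 'p) \<Rightarrow> ('h \<Rightarrow> 'r, 'm) module \<Rightarrow> int \<Rightarrow> ('p \<Rightarrow> 'm) set"
  where "cocycles R K P d M n = {f \<in> carrier (hom_module R K (P n) M).
    compose (carrier (P (n + 1))) f (d (n + 1)) = \<zero>\<^bsub>hom_module R K (P (n + 1)) M\<^esub>}"

definition coboundaries ::
    "('r, 'e) ring_scheme \<Rightarrow> ('h, 'k) monoid_scheme \<Rightarrow> (int \<Rightarrow> ('h \<Rightarrow> 'r, 'p) module) \<Rightarrow>
     (int \<Rightarrow> 'p \<Rightarrow> 'p) \<Rightarrow> ('h \<Rightarrow> 'r, 'm) module \<Rightarrow> int \<Rightarrow> ('p \<Rightarrow> 'm) set"
  where "coboundaries R K P d M n =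
    (\<lambda>f. compose (carrier (P n)) f (d n)) ` carrier (hom_module R K (P (n - 1)) M)"

definition projective_resolution ::
    "('a, 'e) ring_scheme \<Rightarrow> ('a, 'm) module \<Rightarrow> (int \<Rightarrow> ('a, 'q) module) \<Rightarrow>
     (int \<Rightarrow> 'q \<Rightarrow> 'q) \<Rightarrow> ('q \<Rightarrow> 'm) \<Rightarrow> bool"
  where "projective_resolution A M Q \<delta> \<epsilon> \<longleftrightarrow>
    (\<forall>n. left_module A (Q n) \<and> \<delta> n \<in> lmod_hom A (Q n) (Q (n - 1))) \<and>
    (\<forall>n\<ge>0. projective A (Q n)) \<and>
    (\<forall>n<0. carrier (Q n) = {\<zero>\<^bsub>Q n\<^esub>}) \<and>
    (\<forall>n>0. a_kernel (Q n) (Q (n - 1)) (\<delta> n) = \<delta> (n + 1) ` carrier (Q (n + 1))) \<and>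
    \<epsilon> \<in> lmod_hom A (Q 0) M \<and>
    a_kernel (Q 0) M \<epsilon> = \<delta> 1 ` carrier (Q 1) \<and>
    \<epsilon> ` carrier (Q 0) = carrier M"

text \<open>Taking \<open>Q\<close> with elements of the same type as \<open>P\<close> loses nothing, since \<open>Q n\<close> is isomorphic to
  \<open>P n\<close> for \<open>n \<ge> 0\<close> and zero otherwise.\<close>

definition complete_resolution ::
    "('r, 'e) ring_scheme \<Rightarrow> ('h, 'k) monoid_scheme \<Rightarrow> (int \<Rightarrow> ('h \<Rightarrow> 'r, 'p) module) \<Rightarrow>
     (int \<Rightarrow> 'p \<Rightarrow> 'p) \<Rightarrow> bool"
  where "complete_resolution R K P d \<longleftrightarrow>
    (\<forall>n. left_module (group_ring R K) (P n) \<and> finitely_generated (group_ring R K) (P n) \<and>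
      projective (group_ring R K) (P n)) \<and>
    (\<forall>n. d n \<in> lmod_hom (group_ring R K) (P n) (P (n - 1))) \<and>
    (\<forall>n. a_kernel (P n) (P (n - 1)) (d n) = d (n + 1) ` carrier (P (n + 1))) \<and>
    (\<forall>n. cocycles R K P d (regular_module (group_ring R K)) n =
         coboundaries R K P d (regular_module (group_ring R K)) n) \<and>
    (\<exists>(Q :: int \<Rightarrow> ('h \<Rightarrow> 'r, 'p) module) \<delta> \<epsilon> \<tau>.
      projective_resolution (group_ring R K) (trivial_module R K) Q \<delta> \<epsilon> \<and>
      (\<forall>n. \<tau> n \<in> lmod_hom (group_ring R K) (P n) (Q n)) \<and>
      (\<forall>n. \<forall>p\<in>carrier (P n). \<tau> (n - 1) (d n p) = \<delta> n (\<tau> n p)) \<and>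
      (\<forall>n\<ge>0. bij_betw (\<tau> n) (carrier (P n)) (carrier (Q n))) \<and>
      (\<forall>n<0. \<forall>p\<in>carrier (P n). \<tau> n p = \<zero>\<^bsub>Q n\<^esub>))"

definition tate_degree ::
    "('r, 'e) ring_scheme \<Rightarrow> ('h, 'k) monoid_scheme \<Rightarrow> (int \<Rightarrow> ('h \<Rightarrow> 'r, 'p) module) \<Rightarrow>
     (int \<Rightarrow> 'p \<Rightarrow> 'p) \<Rightarrow> ('h \<Rightarrow> 'r, 'm) module \<Rightarrow> int \<Rightarrow> ('r, ('p \<Rightarrow> 'm) set) module"
  where "tate_degree R K P d M n =
    quotient_module ((hom_module R K (P n) M)\<lparr>carrier := cocycles R K P d M n\<rparr>)
      (coboundaries R K P d M n)"

definition tate ::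
    "('r, 'e) ring_scheme \<Rightarrow> ('h, 'k) monoid_scheme \<Rightarrow> (int \<Rightarrow> ('h \<Rightarrow> 'r, 'p) module) \<Rightarrow>
     (int \<Rightarrow> 'p \<Rightarrow> 'p) \<Rightarrow> ('h \<Rightarrow> 'r, 'm) module \<Rightarrow> ('r, int \<Rightarrow> ('p \<Rightarrow> 'm) set) module"
  where "tate R K P d M = direct_sum UNIV (tate_degree R K P d M)"

definition tate_homogeneous ::
    "('r, 'e) ring_scheme \<Rightarrow> ('h, 'k) monoid_scheme \<Rightarrow> (int \<Rightarrow> ('h \<Rightarrow> 'r, 'p) module) \<Rightarrow>
     (int \<Rightarrow> 'p \<Rightarrow> 'p) \<Rightarrow> ('h \<Rightarrow> 'r, 'm) module \<Rightarrow> int \<Rightarrow> (int \<Rightarrow> ('p \<Rightarrow> 'm) set) set"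
  where "tate_homogeneous R K P d M n =
    {\<zeta> \<in> carrier (tate R K P d M). \<forall>m. m \<noteq> n \<longrightarrow> \<zeta> m = \<zero>\<^bsub>tate_degree R K P d M m\<^esub>}"

text \<open>The map induced on cohomology by a cochain map \<open>F\<close> with values in \<open>Hom\<^sub>R\<^sub>K(P, N)\<close>: the class
  of \<open>f\<close> goes to the class of \<open>F n f\<close>. For a cochain map all cosets in the union coincide.\<close>

definition tate_map ::
    "('r, 'e) ring_scheme \<Rightarrow> ('h, 'k) monoid_scheme \<Rightarrow> (int \<Rightarrow> ('h \<Rightarrow> 'r, 'p) module) \<Rightarrow>
     (int \<Rightarrow> 'p \<Rightarrow> 'p) \<Rightarrow> ('h \<Rightarrow> 'r, 'n) module \<Rightarrow> (int \<Rightarrow> ('p \<Rightarrow> 'm) \<Rightarrow> ('p \<Rightarrow> 'n)) \<Rightarrow>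
     (int \<Rightarrow> ('p \<Rightarrow> 'm) set) \<Rightarrow> (int \<Rightarrow> ('p \<Rightarrow> 'n) set)"
  where "tate_map R K P d N F \<zeta> =
    (\<lambda>n. \<Union>f\<in>\<zeta> n. coboundaries R K P d N n +>\<^bsub>hom_module R K (P n) N\<^esub> F n f)"

definition tate_coeff_map ::
    "('r, 'e) ring_scheme \<Rightarrow> ('h, 'k) monoid_scheme \<Rightarrow> (int \<Rightarrow> ('h \<Rightarrow> 'r, 'p) module) \<Rightarrow>
     (int \<Rightarrow> 'p \<Rightarrow> 'p) \<Rightarrow> ('h \<Rightarrow> 'r, 'n) module \<Rightarrow> ('m \<Rightarrow> 'n) \<Rightarrow>
     (int \<Rightarrow> ('p \<Rightarrow> 'm) set) \<Rightarrow> (int \<Rightarrow> ('p \<Rightarrow> 'n) set)"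
  where "tate_coeff_map R K P d N \<eta> =
    tate_map R K P d N (\<lambda>n f. compose (carrier (P n)) \<eta> f)"

text \<open>Restriction to a subgroup \<open>L\<close>; the source group does not enter the formula.\<close>

definition tate_res ::
    "('r, 'e) ring_scheme \<Rightarrow> ('h, 'k) monoid_scheme \<Rightarrow> (int \<Rightarrow> ('h \<Rightarrow> 'r, 'p) module) \<Rightarrow>
     (int \<Rightarrow> 'p \<Rightarrow> 'p) \<Rightarrow> ('h \<Rightarrow> 'r, 'm) module \<Rightarrow>
     (int \<Rightarrow> ('p \<Rightarrow> 'm) set) \<Rightarrow> (int \<Rightarrow> ('p \<Rightarrow> 'm) set)"
  where "tate_res R L P d M = tate_map R L P d M (\<lambda>n f. f)"

definition left_coset_reps :: "('h, 'k) monoid_scheme \<Rightarrow> 'h set \<Rightarrow> 'h set \<Rightarrow> bool"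
  where "left_coset_reps K L U \<longleftrightarrow> U \<subseteq> carrier K \<and> (\<forall>x\<in>carrier K. \<exists>!u. u \<in> U \<and> x \<in> u <#\<^bsub>K\<^esub> L)"

text \<open>Corestriction to \<open>K\<close>, computed with a set \<open>U\<close> of representatives of the left cosets in \<open>K\<close> of
  the subgroup one starts from.\<close>

definition tate_cor ::
    "('r, 'e) ring_scheme \<Rightarrow> ('h, 'k) monoid_scheme \<Rightarrow> 'h set \<Rightarrow>
     (int \<Rightarrow> ('h \<Rightarrow> 'r, 'p) module) \<Rightarrow> (int \<Rightarrow> 'p \<Rightarrow> 'p) \<Rightarrow> ('h \<Rightarrow> 'r, 'm) module \<Rightarrow>
     (int \<Rightarrow> ('p \<Rightarrow> 'm) set) \<Rightarrow> (int \<Rightarrow> ('p \<Rightarrow> 'm) set)"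
  where "tate_cor R K U P d M = tate_map R K P d M (\<lambda>n f. \<lambda>p\<in>carrier (P n).
    \<Oplus>\<^bsub>M\<^esub>u\<in>U. gr_single R u \<one>\<^bsub>R\<^esub> \<odot>\<^bsub>M\<^esub> f (gr_single R (inv\<^bsub>K\<^esub> u) \<one>\<^bsub>R\<^esub> \<odot>\<^bsub>P n\<^esub> p))"

end

(* Everything happens on cochains. A homomorphism f from P n to RG over RH is determined by its
   coefficients at the representatives g i, because by equivariance the coefficient of h y in f p is
   that of y in f (h^-1 p). The maps p_i taking the coefficient at g i, after restriction to the
   stabilizer of g i, and q_i = cor o theta commute with the differentials and satisfy
   p_j o q_i = 0 for i distinct from j and p_i o q_i = id: in the transfer sum only the coset of the
   stabilizer itself contributes to the coefficient at g i. *)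
theory Submission
  imports Defs
begin

text \<open>As an H-module, RG is the direct sum over the orbits of the permutation modules
  R[H/H_i], and Hom over RH from P into R[H/H_i] is Hom over RH_i from P into R, because induction
  and coinduction agree for finite groups. This is why an isomorphism exists already on cochains,
  degree by degree. The identity that the sum of the q_i p_i is the identity is never computed: the
  relations p_j q_i together with joint injectivity of the p_i force it. The obstacle is that the
  p_i and q_i relate modules over different group rings. Coefficient functions on H vanishing
  outside H_i make RH_i a subring of RH, so one complex P serves every subgroup, restriction is the
  identity on cochains, and linearity over RH_i can be tested on the elements r h with h in
  H_i.\<close>

lemma lmod_homI:
  assumes "\<And>x. x \<in> carrier M \<Longrightarrow> f x \<in> carrier N"
    and "\<And>x y. \<lbrakk>x \<in> carrier M; y \<in> carrier M\<rbrakk> \<Longrightarrow> f (x \<oplus>\<^bsub>M\<^esub> y) = f x \<oplus>\<^bsub>N\<^esub> f y"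
    and "\<And>a x. \<lbrakk>a \<in> carrier A; x \<in> carrier M\<rbrakk> \<Longrightarrow> f (a \<odot>\<^bsub>M\<^esub> x) = a \<odot>\<^bsub>N\<^esub> f x"
  shows "f \<in> lmod_hom A M N"
  using assms by (auto simp: lmod_hom_def hom_def)

lemma lmod_homD:
  assumes "f \<in> lmod_hom A M N"
  shows "\<And>x. x \<in> carrier M \<Longrightarrow> f x \<in> carrier N"
    and "\<And>x y. \<lbrakk>x \<in> carrier M; y \<in> carrier M\<rbrakk> \<Longrightarrow> f (x \<oplus>\<^bsub>M\<^esub> y) = f x \<oplus>\<^bsub>N\<^esub> f y"
    and "\<And>a x. \<lbrakk>a \<in> carrier A; x \<in> carrier M\<rbrakk> \<Longrightarrow> f (a \<odot>\<^bsub>M\<^esub> x) = a \<odot>\<^bsub>N\<^esub> f x"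
  using assms by (auto simp: lmod_hom_def hom_def)

section \<open>Homomorphisms of abelian groups\<close>

lemma abelian_group_hom_additiveI:
  assumes "abelian_group M" "abelian_group N"
    and "\<And>x. x \<in> carrier M \<Longrightarrow> f x \<in> carrier N"
    and "\<And>x y. \<lbrakk>x \<in> carrier M; y \<in> carrier M\<rbrakk> \<Longrightarrow> f (x \<oplus>\<^bsub>M\<^esub> y) = f x \<oplus>\<^bsub>N\<^esub> f y"
  shows "abelian_group_hom M N f"
proof -
  have "f \<in> hom (add_monoid M) (add_monoid N)" using assms(3,4) by (auto simp: hom_def)
  then show ?thesis
    by (intro abelian_group_homI group_hom.intro group_hom_axioms.intro abelian_group.a_group assms(1,2))
qed

lemma lmod_hom_abelian_group_hom:
  assumes "f \<in> lmod_hom A M N" "abelian_group M" "abelian_group N"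
  shows "abelian_group_hom M N f"
  by (rule abelian_group_hom_additiveI[OF assms(2,3)]) (simp_all add: lmod_homD[OF assms(1)])

lemma (in abelian_group_hom) hom_minus:
  assumes "x \<in> carrier G" "y \<in> carrier G"
  shows "h (x \<ominus>\<^bsub>G\<^esub> y) = h x \<ominus>\<^bsub>H\<^esub> h y"
  using assms by (simp add: a_minus_def)

text \<open>For infinite \<open>A\<close> both sums are zero by convention and \<open>h\<close>
  preserves zero; for finite \<open>A\<close> additivity splits off one summand at a time.\<close>

lemma (in abelian_group_hom) hom_finsum:
  assumes "f \<in> A \<rightarrow> carrier G"
  shows "h (\<Oplus>\<^bsub>G\<^esub>i\<in>A. f i) = (\<Oplus>\<^bsub>H\<^esub>i\<in>A. h (f i))"
  using assms by (induction A rule: infinite_finite_induct) (auto simp: Pi_def)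

lemma minus_eq_zero_iff:
  assumes "abelian_group M" "x \<in> carrier M" "y \<in> carrier M"
  shows "x \<ominus>\<^bsub>M\<^esub> y = \<zero>\<^bsub>M\<^esub> \<longleftrightarrow> x = y"
proof -
  interpret abelian_group M by fact
  show ?thesis using assms(2,3) by (metis a_minus_def a_inv_closed minus_equality r_neg add.m_comm minus_minus)
qed

subsection \<open>Quotients and direct sums\<close>

text \<open>It is used with the module of cocycles as \<open>M\<close> and the coboundaries as
  \<open>B\<close>.\<close>

locale module_quotient = module R M for R and M :: "('a, 'm) module" +
  fixes B :: "'m set"
  assumes submodule: "submodule B R M"
begin

sublocale B: abelian_subgroup B M
  using submodule by (intro abelian_subgroupI3 additive_subgroupI)
    (auto simp: submodule_def M.abelian_group_axioms)

lemma coset_eq_iff: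
  assumes "x \<in> carrier M" "y \<in> carrier M"
  shows "B +>\<^bsub>M\<^esub> x = B +>\<^bsub>M\<^esub> y \<longleftrightarrow> x \<ominus>\<^bsub>M\<^esub> y \<in> B"
proof -
  have "x \<ominus>\<^bsub>M\<^esub> y \<in> B \<longleftrightarrow> x \<in> B +>\<^bsub>M\<^esub> y"
    using B.a_rcos_module[OF assms(2,1)] by (simp add: a_minus_def)
  also have "\<dots> \<longleftrightarrow> B +>\<^bsub>M\<^esub> x = B +>\<^bsub>M\<^esub> y"
    using B.a_repr_independence'[OF _ assms(2)] B.a_rcos_self[OF assms(1)] by metis
  finally show ?thesis by simp
qed

lemma coset_elim:
  assumes "y \<in> B +>\<^bsub>M\<^esub> x"
  obtains b where "b \<in> B" "b \<in> carrier M" "y = b \<oplus>\<^bsub>M\<^esub> x"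
  using assms that B.a_subset by (auto simp: a_r_coset_def')

lemma add_coset_eq:
  assumes "b \<in> B" "x \<in> carrier M"
  shows "B +>\<^bsub>M\<^esub> (b \<oplus>\<^bsub>M\<^esub> x) = B +>\<^bsub>M\<^esub> x"
proof -
  have "b \<in> carrier M" using B.a_subset assms(1) by auto
  then have "(b \<oplus>\<^bsub>M\<^esub> x) \<ominus>\<^bsub>M\<^esub> x = b"
    using assms(2) by (simp add: a_minus_def M.a_assoc M.r_neg)
  then show ?thesis using coset_eq_iff[of "b \<oplus>\<^bsub>M\<^esub> x" x] assms \<open>b \<in> carrier M\<close> by simp
qed

lemma carrier_quotient: "carrier (quotient_module M B) = {B +>\<^bsub>M\<^esub> x | x. x \<in> carrier M}"
  by (auto simp: quotient_module_def A_RCOSETS_def RCOSETS_def a_r_coset_def)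

lemma quotient_add:
  assumes "x \<in> carrier M" "y \<in> carrier M"
  shows "(B +>\<^bsub>M\<^esub> x) \<oplus>\<^bsub>quotient_module M B\<^esub> (B +>\<^bsub>M\<^esub> y) = B +>\<^bsub>M\<^esub> (x \<oplus>\<^bsub>M\<^esub> y)"
  using B.a_rcos_sum[OF assms] by (simp add: quotient_module_def)

lemma quotient_zero: "\<zero>\<^bsub>quotient_module M B\<^esub> = B +>\<^bsub>M\<^esub> \<zero>\<^bsub>M\<^esub>"
  using B.a_subset by (simp add: quotient_module_def)

text \<open>\<open>quotient_module\<close> takes a union over all representatives of the coset. Two
  of them differ by some b in \<open>B\<close>, and a b lies in \<open>B\<close> again, so all
  cosets in the union coincide.\<close>

lemma quotient_smult:
  assumes "a \<in> carrier R" "x \<in> carrier M"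
  shows "a \<odot>\<^bsub>quotient_module M B\<^esub> (B +>\<^bsub>M\<^esub> x) = B +>\<^bsub>M\<^esub> (a \<odot>\<^bsub>M\<^esub> x)"
proof -
  have "B +>\<^bsub>M\<^esub> (a \<odot>\<^bsub>M\<^esub> y) = B +>\<^bsub>M\<^esub> (a \<odot>\<^bsub>M\<^esub> x)" if y: "y \<in> B +>\<^bsub>M\<^esub> x" for y
  proof -
    obtain b where b: "b \<in> B" "b \<in> carrier M" "y = b \<oplus>\<^bsub>M\<^esub> x" using coset_elim[OF y] .
    then show ?thesis
      using add_coset_eq[of "a \<odot>\<^bsub>M\<^esub> b"] assms submoduleE(4)[OF submodule]
      by (simp add: smult_r_distr)
  qed
  then have "(\<Union>y\<in>B +>\<^bsub>M\<^esub> x. B +>\<^bsub>M\<^esub> (a \<odot>\<^bsub>M\<^esub> y)) = B +>\<^bsub>M\<^esub> (a \<odot>\<^bsub>M\<^esub> x)"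
    using B.a_rcos_self[OF assms(2)] by (intro SUP_eq_const) blast+
  then show ?thesis by (simp add: quotient_module_def)
qed

lemmas quotient_simps = carrier_quotient quotient_add quotient_smult quotient_zero

lemma quotient_is_module: "module R (quotient_module M B)"
proof (rule moduleI)
  let ?Q = "quotient_module M B"
  show "abelian_group ?Q"
  proof (rule abelian_groupI)
    show "\<exists>y\<in>carrier ?Q. y \<oplus>\<^bsub>?Q\<^esub> x = \<zero>\<^bsub>?Q\<^esub>" if x: "x \<in> carrier ?Q" for x
    proof -
      obtain m where m: "m \<in> carrier M" "x = B +>\<^bsub>M\<^esub> m" using x by (auto simp: carrier_quotient)
      then show ?thesis
        by (intro bexI[of _ "B +>\<^bsub>M\<^esub> (\<ominus>\<^bsub>M\<^esub> m)"]) (auto simp: quotient_simps M.l_neg)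
    qed
  qed (auto simp: quotient_simps M.a_assoc M.a_comm M.a_lcomm)
qed (auto simp: quotient_simps R.is_cring smult_l_distr smult_r_distr smult_assoc1)

end

section \<open>Direct sums, and isomorphisms assembled from components\<close>

lemma direct_sum_simps [simp]:
  "\<zero>\<^bsub>direct_sum I M\<^esub> = (\<lambda>i\<in>I. \<zero>\<^bsub>M i\<^esub>)"
  "x \<oplus>\<^bsub>direct_sum I M\<^esub> y = (\<lambda>i\<in>I. x i \<oplus>\<^bsub>M i\<^esub> y i)"
  "a \<odot>\<^bsub>direct_sum I M\<^esub> x = (\<lambda>i\<in>I. a \<odot>\<^bsub>M i\<^esub> x i)"
  by (simp_all add: direct_sum_def)

lemma carrier_direct_sum:
  "x \<in> carrier (direct_sum I M) \<longleftrightarrow>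
     x \<in> extensional I \<and> (\<forall>i\<in>I. x i \<in> carrier (M i)) \<and> finite {i \<in> I. x i \<noteq> \<zero>\<^bsub>M i\<^esub>}"
  by (auto simp: direct_sum_def PiE_def)

text \<open>The axioms hold componentwise. The point to check is that supports stay finite: the
  support of a sum lies in the union of two supports, and negatives and scalar multiples do not
  enlarge a support.\<close>

lemma direct_sum_is_module:
  assumes R: "cring R" and M: "\<And>i. i \<in> I \<Longrightarrow> module R (M i)"
  shows "module R (direct_sum I M)"
proof -
  have ab: "abelian_group (M i)" if "i \<in> I" for i using M[OF that] by (simp add: module_def)
  show ?thesis
  proof (rule moduleI)
    show "abelian_group (direct_sum I M)"
    proof (rule abelian_groupI)
      fix x y assume xy: "x \<in> carrier (direct_sum I M)" "y \<in> carrier (direct_sum I M)"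
      have "{i \<in> I. x i \<oplus>\<^bsub>M i\<^esub> y i \<noteq> \<zero>\<^bsub>M i\<^esub>} \<subseteq> {i \<in> I. x i \<noteq> \<zero>\<^bsub>M i\<^esub>} \<union> {i \<in> I. y i \<noteq> \<zero>\<^bsub>M i\<^esub>}"
        using abelian_monoid.l_zero[OF abelian_group.axioms(1)[OF ab]]
              abelian_monoid.zero_closed[OF abelian_group.axioms(1)[OF ab]] by auto
      then have "finite {i \<in> I. x i \<oplus>\<^bsub>M i\<^esub> y i \<noteq> \<zero>\<^bsub>M i\<^esub>}"
        using xy by (auto simp: carrier_direct_sum intro: finite_subset)
      then show "x \<oplus>\<^bsub>direct_sum I M\<^esub> y \<in> carrier (direct_sum I M)"
        using xy abelian_monoid.a_closed[OF abelian_group.axioms(1)[OF ab]]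
        by (auto simp: carrier_direct_sum cong: conj_cong)
      show "x \<oplus>\<^bsub>direct_sum I M\<^esub> y = y \<oplus>\<^bsub>direct_sum I M\<^esub> x"
        using xy abelian_monoid.a_comm[OF abelian_group.axioms(1)[OF ab]]
        by (auto simp: carrier_direct_sum intro!: restrict_ext)
      fix z assume "z \<in> carrier (direct_sum I M)"
      then show "x \<oplus>\<^bsub>direct_sum I M\<^esub> y \<oplus>\<^bsub>direct_sum I M\<^esub> z = x \<oplus>\<^bsub>direct_sum I M\<^esub> (y \<oplus>\<^bsub>direct_sum I M\<^esub> z)"
        using xy abelian_monoid.a_assoc[OF abelian_group.axioms(1)[OF ab]]
        by (auto simp: carrier_direct_sum intro!: restrict_ext)
    next
      fix x assume x: "x \<in> carrier (direct_sum I M)"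
      show "\<zero>\<^bsub>direct_sum I M\<^esub> \<oplus>\<^bsub>direct_sum I M\<^esub> x = x"
        using x abelian_monoid.l_zero[OF abelian_group.axioms(1)[OF ab]]
        by (auto simp: carrier_direct_sum intro!: extensionalityI[of _ I])
      have "{i \<in> I. \<ominus>\<^bsub>M i\<^esub> x i \<noteq> \<zero>\<^bsub>M i\<^esub>} \<subseteq> {i \<in> I. x i \<noteq> \<zero>\<^bsub>M i\<^esub>}"
      proof safe
        fix i assume i: "i \<in> I" "\<ominus>\<^bsub>M i\<^esub> x i \<noteq> \<zero>\<^bsub>M i\<^esub>" "x i = \<zero>\<^bsub>M i\<^esub>"
        interpret abelian_group "M i" using ab[OF i(1)] .
        show False using i by (simp add: add.inv_one)
      qed
      then have "finite {i \<in> I. \<ominus>\<^bsub>M i\<^esub> x i \<noteq> \<zero>\<^bsub>M i\<^esub>}"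
        using x by (auto simp: carrier_direct_sum intro: finite_subset)
      then show "\<exists>y\<in>carrier (direct_sum I M). y \<oplus>\<^bsub>direct_sum I M\<^esub> x = \<zero>\<^bsub>direct_sum I M\<^esub>"
        using x abelian_group.a_inv_closed[OF ab] abelian_group.l_neg[OF ab]
        by (intro bexI[of _ "\<lambda>i\<in>I. \<ominus>\<^bsub>M i\<^esub> x i"])
          (auto simp: carrier_direct_sum intro!: restrict_ext cong: conj_cong)
    next
      show "\<zero>\<^bsub>direct_sum I M\<^esub> \<in> carrier (direct_sum I M)"
        using abelian_monoid.zero_closed[OF abelian_group.axioms(1)[OF ab]]
        by (auto simp: carrier_direct_sum cong: conj_cong)
    qed
  next
    fix a x assume a: "a \<in> carrier R" and x: "x \<in> carrier (direct_sum I M)"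
    have "{i \<in> I. a \<odot>\<^bsub>M i\<^esub> x i \<noteq> \<zero>\<^bsub>M i\<^esub>} \<subseteq> {i \<in> I. x i \<noteq> \<zero>\<^bsub>M i\<^esub>}"
      using module.smult_r_null[OF M a] by auto
    then have "finite {i \<in> I. a \<odot>\<^bsub>M i\<^esub> x i \<noteq> \<zero>\<^bsub>M i\<^esub>}"
      using x by (auto simp: carrier_direct_sum intro: finite_subset)
    then show "a \<odot>\<^bsub>direct_sum I M\<^esub> x \<in> carrier (direct_sum I M)"
      using x a module.smult_closed[OF M] by (auto simp: carrier_direct_sum cong: conj_cong)
  next
    show "\<one>\<^bsub>R\<^esub> \<odot>\<^bsub>direct_sum I M\<^esub> x = x" if "x \<in> carrier (direct_sum I M)" for x
      using that module.smult_one[OF M] by (auto simp: carrier_direct_sum intro!: extensionalityI[of _ I])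
  qed (auto simp: R carrier_direct_sum module.smult_l_distr[OF M] module.smult_r_distr[OF M]
        module.smult_assoc1[OF M] intro!: restrict_ext)
qed

lemma lmod_hom_zero:
  assumes "f \<in> lmod_hom R M N" "module R M" "module R N"
  shows "f \<zero>\<^bsub>M\<^esub> = \<zero>\<^bsub>N\<^esub>"
proof -
  interpret abelian_group_hom M N f
    using assms by (intro lmod_hom_abelian_group_hom) (auto simp: module_def)
  show ?thesis by simp
qed

text \<open>Each \<open>f i\<close> preserves zero, so the image has no larger support than its
  argument.\<close>

lemma lmod_hom_direct_sum:
  assumes "\<And>i. i \<in> I \<Longrightarrow> module R (M i)" "\<And>i. i \<in> I \<Longrightarrow> module R (N i)"
    and f: "\<And>i. i \<in> I \<Longrightarrow> f i \<in> lmod_hom R (M i) (N i)"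
  shows "(\<lambda>x. \<lambda>i\<in>I. f i (x i)) \<in> lmod_hom R (direct_sum I M) (direct_sum I N)"
proof (rule lmod_homI)
  fix x assume x: "x \<in> carrier (direct_sum I M)"
  have "{i \<in> I. f i (x i) \<noteq> \<zero>\<^bsub>N i\<^esub>} \<subseteq> {i \<in> I. x i \<noteq> \<zero>\<^bsub>M i\<^esub>}"
    using lmod_hom_zero[OF f assms(1,2)] by force
  then have "finite {i \<in> I. f i (x i) \<noteq> \<zero>\<^bsub>N i\<^esub>}"
    using x by (auto simp: carrier_direct_sum intro: finite_subset)
  then show "(\<lambda>i\<in>I. f i (x i)) \<in> carrier (direct_sum I N)"
    using x lmod_homD(1)[OF f] by (auto simp: carrier_direct_sum cong: conj_cong)
qed (auto simp: carrier_direct_sum lmod_homD[OF f] intro!: restrict_ext)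

text \<open>By \<open>pq\<close> the sum of the q_i is a right inverse of the tuple of the p_i in
  every degree, and by \<open>inj\<close> that tuple is injective, so the right inverse is
  two-sided. Finiteness of \<open>I\<close> makes the sum of the q_i meaningful and leaves only
  finitely many nonzero degrees.\<close>

theorem graded_iso_direct_sum:
  fixes M :: "int \<Rightarrow> ('a, 'm) module" and N :: "'i \<Rightarrow> int \<Rightarrow> ('a, 'n) module"
  assumes I: "finite I"
    and R: "cring R" and M: "\<And>n. module R (M n)" and N: "\<And>i n. i \<in> I \<Longrightarrow> module R (N i n)"
    and p: "\<And>i n. i \<in> I \<Longrightarrow> p i n \<in> lmod_hom R (M n) (N i n)"
    and q: "\<And>i n. i \<in> I \<Longrightarrow> q i n \<in> lmod_hom R (N i n) (M n)"
    and pq: "\<And>i j n x. \<lbrakk>i \<in> I; j \<in> I; x \<in> carrier (N i n)\<rbrakk> \<Longrightarrow>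
      p j n (q i n x) = (if j = i then x else \<zero>\<^bsub>N j n\<^esub>)"
    and inj: "\<And>n x. \<lbrakk>x \<in> carrier (M n); \<And>i. i \<in> I \<Longrightarrow> p i n x = \<zero>\<^bsub>N i n\<^esub>\<rbrakk> \<Longrightarrow> x = \<zero>\<^bsub>M n\<^esub>"
  defines "V \<equiv> direct_sum UNIV M" and "Y \<equiv> \<lambda>i. direct_sum UNIV (N i)"
  defines "S \<equiv> direct_sum I Y" and "\<Phi> \<equiv> \<lambda>\<zeta>. \<lambda>i\<in>I. \<lambda>n. p i n (\<zeta> n)"
  shows "graded_iso R V (\<lambda>n. {\<zeta> \<in> carrier V. \<forall>m. m \<noteq> n \<longrightarrow> \<zeta> m = \<zero>\<^bsub>M m\<^esub>}) S
      (\<lambda>n. {x \<in> carrier S. \<forall>i\<in>I. x i \<in> {\<zeta> \<in> carrier (Y i). \<forall>m. m \<noteq> n \<longrightarrow> \<zeta> m = \<zero>\<^bsub>N i m\<^esub>}}) \<Phi>"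
      (is ?iso)
    and "\<lbrakk>i \<in> I; \<alpha> \<in> carrier (Y i)\<rbrakk> \<Longrightarrow>
      inv_into (carrier V) \<Phi> (\<lambda>j\<in>I. if j = i then \<alpha> else \<zero>\<^bsub>Y j\<^esub>) = (\<lambda>n. q i n (\<alpha> n))"
proof -
  have XM: "module R V" unfolding V_def by (intro direct_sum_is_module R M)
  have YM: "module R (Y i)" if "i \<in> I" for i unfolding Y_def by (intro direct_sum_is_module R N that)
  have SM: "module R S" unfolding S_def by (intro direct_sum_is_module R YM)
  have abM: "abelian_group (M n)" for n using M by (simp add: module_def)
  have abN: "abelian_group (N i n)" if "i \<in> I" for i n using N[OF that] by (simp add: module_def)
  have p_hom: "abelian_group_hom (M n) (N i n) (p i n)" if "i \<in> I" for i n
    by (intro lmod_hom_abelian_group_hom[OF p] abM abN that)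
  have comp: "(\<lambda>\<zeta> n. p i n (\<zeta> n)) \<in> lmod_hom R V (Y i)" if "i \<in> I" for i
    using lmod_hom_direct_sum[of UNIV R M "N i" "p i"] M N p that unfolding V_def Y_def
    by (simp add: restrict_def)
  have comq: "(\<lambda>\<zeta> n. q i n (\<zeta> n)) \<in> lmod_hom R (Y i) V" if "i \<in> I" for i
    using lmod_hom_direct_sum[of UNIV R "N i" M "q i"] M N q that unfolding V_def Y_def
    by (simp add: restrict_def)
  have V_carr: "x \<in> carrier V \<longleftrightarrow> (\<forall>n. x n \<in> carrier (M n)) \<and> finite {n. x n \<noteq> \<zero>\<^bsub>M n\<^esub>}" for x
    by (simp add: V_def carrier_direct_sum)
  have Y_carr: "x \<in> carrier (Y i) \<longleftrightarrow> (\<forall>n. x n \<in> carrier (N i n)) \<and> finite {n. x n \<noteq> \<zero>\<^bsub>N i n\<^esub>}" for x i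
    by (simp add: Y_def carrier_direct_sum)
  \<comment> \<open>Since \<open>I\<close> is finite, the support condition of the outer direct sum
    holds automatically.\<close>
  have S_carr: "x \<in> carrier S \<longleftrightarrow> x \<in> extensional I \<and> (\<forall>i\<in>I. x i \<in> carrier (Y i))" for x
    using I by (simp add: S_def carrier_direct_sum)
  have \<Phi>_hom: "\<Phi> \<in> lmod_hom R V S"
  proof (rule lmod_homI)
    show "\<Phi> x \<in> carrier S" if "x \<in> carrier V" for x
      using that lmod_homD(1)[OF comp] by (auto simp: \<Phi>_def S_carr)
    show "\<Phi> (x \<oplus>\<^bsub>V\<^esub> y) = \<Phi> x \<oplus>\<^bsub>S\<^esub> \<Phi> y" if "x \<in> carrier V" "y \<in> carrier V" for x y
      using that lmod_homD(2)[OF comp] by (auto simp: \<Phi>_def S_def intro!: restrict_ext)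
    show "\<Phi> (a \<odot>\<^bsub>V\<^esub> x) = a \<odot>\<^bsub>S\<^esub> \<Phi> x" if "a \<in> carrier R" "x \<in> carrier V" for a x
      using that lmod_homD(3)[OF comp] by (auto simp: \<Phi>_def S_def intro!: restrict_ext)
  qed
  \<comment> \<open>Additivity of the p_i turns \<open>inj\<close>, a statement about zero, into
    injectivity: it is applied to the difference of x and y.\<close>
  have \<Phi>_eqD: "x = y" if xy: "x \<in> carrier (M n)" "y \<in> carrier (M n)"
    and eq: "\<And>i. i \<in> I \<Longrightarrow> p i n x = p i n y" for x y n
  proof -
    have "p i n (x \<ominus>\<^bsub>M n\<^esub> y) = \<zero>\<^bsub>N i n\<^esub>" if i: "i \<in> I" for i
      using minus_eq_zero_iff[OF abN[OF i], of "p i n x" n "p i n y"] lmod_homD(1)[OF p[OF i]] xy eq[OF i]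
      by (simp add: abelian_group_hom.hom_minus[OF p_hom[OF i] xy])
    moreover have "x \<ominus>\<^bsub>M n\<^esub> y \<in> carrier (M n)"
      using abelian_group.minus_closed[OF abM xy] .
    ultimately show ?thesis using inj minus_eq_zero_iff[OF abM xy] by blast
  qed
  have \<Phi>_at: "\<Phi> x i n = p i n (x n)" if "i \<in> I" for x i n using that by (simp add: \<Phi>_def)
  have \<Phi>_inj: "inj_on \<Phi> (carrier V)"
  proof (rule inj_onI, rule ext)
    fix x y n assume xy: "x \<in> carrier V" "y \<in> carrier V" and eq: "\<Phi> x = \<Phi> y"
    show "x n = y n"
      using xy by (intro \<Phi>_eqD[of _ n]) (auto simp: V_carr \<Phi>_at[symmetric] eq)
  qed
  have surj: "\<exists>x\<in>carrier V. \<Phi> x = s" if s: "s \<in> carrier S" for s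
  proof -
    \<comment> \<open>The preimage is suggested by \<open>pq\<close>: applying p_j to this sum
      leaves only the j-th component of s.\<close>
    define x where "x n = (\<Oplus>\<^bsub>M n\<^esub>i\<in>I. q i n (s i n))" for n
    have sY: "s i n \<in> carrier (N i n)" if "i \<in> I" for i n using s that by (simp add: S_carr Y_carr)
    have qs: "(\<lambda>i. q i n (s i n)) \<in> I \<rightarrow> carrier (M n)" for n
      using lmod_homD(1)[OF q sY] by auto
    have "x n \<in> carrier (M n)" for n
      unfolding x_def by (intro abelian_monoid.finsum_closed abelian_group.axioms(1) abM qs)
    \<comment> \<open>Outside the finite union of the supports of the components every summand of
      \<open>x n\<close> is the image of zero.\<close>
    moreover have "{n. x n \<noteq> \<zero>\<^bsub>M n\<^esub>} \<subseteq> (\<Union>i\<in>I. {n. s i n \<noteq> \<zero>\<^bsub>N i n\<^esub>})"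
    proof (rule subsetI, rule ccontr)
      fix n assume n: "n \<in> {n. x n \<noteq> \<zero>\<^bsub>M n\<^esub>}" "n \<notin> (\<Union>i\<in>I. {n. s i n \<noteq> \<zero>\<^bsub>N i n\<^esub>})"
      have "x n = (\<Oplus>\<^bsub>M n\<^esub>i\<in>I. \<zero>\<^bsub>M n\<^esub>)"
        unfolding x_def using n(2) lmod_hom_zero[OF q N M]
        by (intro abelian_monoid.finsum_cong' abelian_group.axioms(1) abM)
          (auto intro: abelian_monoid.zero_closed abelian_group.axioms(1) abM)
      then show False
        using n(1) by (simp add: abelian_monoid.finsum_zero[OF abelian_group.axioms(1)[OF abM]])
    qed
    moreover have "finite (\<Union>i\<in>I. {n. s i n \<noteq> \<zero>\<^bsub>N i n\<^esub>})"
      using s I by (auto simp: S_carr Y_carr)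
    ultimately have "x \<in> carrier V" by (auto simp: V_carr intro: finite_subset)
    moreover have "\<Phi> x = s"
    proof (rule extensionalityI[of _ I])
      show "\<Phi> x \<in> extensional I" "s \<in> extensional I" using s by (auto simp: \<Phi>_def S_carr)
      fix j assume j: "j \<in> I"
      show "\<Phi> x j = s j"
      proof
        fix n
        interpret N: abelian_group "N j n" using abN[OF j] .
        have "p j n (x n) = (\<Oplus>\<^bsub>N j n\<^esub>i\<in>I. p j n (q i n (s i n)))"
          unfolding x_def by (rule abelian_group_hom.hom_finsum[OF p_hom[OF j] qs])
        also have "\<dots> = (\<Oplus>\<^bsub>N j n\<^esub>i\<in>I. if j = i then s j n else \<zero>\<^bsub>N j n\<^esub>)"
          using j sY by (intro N.finsum_cong') (auto simp: pq)
        also have "\<dots> = s j n"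
          using N.finsum_singleton[OF j I, of "\<lambda>_. s j n"] sY[OF j] by simp
        finally show "\<Phi> x j n = s j n" using j by (simp add: \<Phi>_at)
      qed
    qed
    ultimately show ?thesis by blast
  qed
  have bij: "bij_betw \<Phi> (carrier V) (carrier S)"
    using \<Phi>_inj surj lmod_homD(1)[OF \<Phi>_hom] by (auto simp: bij_betw_def)
  have graded: "\<Phi> ` {\<zeta> \<in> carrier V. \<forall>m. m \<noteq> n \<longrightarrow> \<zeta> m = \<zero>\<^bsub>M m\<^esub>} =
      {x \<in> carrier S. \<forall>i\<in>I. x i \<in> {\<zeta> \<in> carrier (Y i). \<forall>m. m \<noteq> n \<longrightarrow> \<zeta> m = \<zero>\<^bsub>N i m\<^esub>}}" for n
  proof (intro equalityI subsetI)
    fix y assume "y \<in> \<Phi> ` {\<zeta> \<in> carrier V. \<forall>m. m \<noteq> n \<longrightarrow> \<zeta> m = \<zero>\<^bsub>M m\<^esub>}"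
    then obtain x where x: "x \<in> carrier V" "\<And>m. m \<noteq> n \<Longrightarrow> x m = \<zero>\<^bsub>M m\<^esub>" "y = \<Phi> x" by auto
    then show "y \<in> {x \<in> carrier S. \<forall>i\<in>I. x i \<in> {\<zeta> \<in> carrier (Y i). \<forall>m. m \<noteq> n \<longrightarrow> \<zeta> m = \<zero>\<^bsub>N i m\<^esub>}}"
      using lmod_homD(1)[OF \<Phi>_hom x(1)] lmod_hom_zero[OF p M N] by (auto simp: S_carr \<Phi>_at)
  next
    fix y assume y: "y \<in> {x \<in> carrier S. \<forall>i\<in>I. x i \<in> {\<zeta> \<in> carrier (Y i). \<forall>m. m \<noteq> n \<longrightarrow> \<zeta> m = \<zero>\<^bsub>N i m\<^esub>}}"
    then obtain x where x: "x \<in> carrier V" "\<Phi> x = y" using surj by blast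
    \<comment> \<open>All components of y vanish in degree m, so every p_i kills \<open>x m\<close>
      and joint injectivity applies; the preimage therefore has the same degree as y.\<close>
    have "x m = \<zero>\<^bsub>M m\<^esub>" if "m \<noteq> n" for m
    proof (rule inj)
      show "p i m (x m) = \<zero>\<^bsub>N i m\<^esub>" if "i \<in> I" for i
        using y x(2) \<open>m \<noteq> n\<close> that \<Phi>_at[OF that, of x m] by auto
    qed (use x(1) V_carr in auto)
    with x show "y \<in> \<Phi> ` {\<zeta> \<in> carrier V. \<forall>m. m \<noteq> n \<longrightarrow> \<zeta> m = \<zero>\<^bsub>M m\<^esub>}" by auto
  qed
  show ?iso unfolding graded_iso_def using XM SM \<Phi>_hom bij graded by auto
  show "inv_into (carrier V) \<Phi> (\<lambda>j\<in>I. if j = i then \<alpha> else \<zero>\<^bsub>Y j\<^esub>) = (\<lambda>n. q i n (\<alpha> n))"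
    if i: "i \<in> I" and \<alpha>: "\<alpha> \<in> carrier (Y i)"
  \<comment> \<open>The inverse is evaluated by exhibiting a preimage: by \<open>pq\<close> the
    tuple of the p_j sends q_i \<alpha> to \<alpha> in place i and to zero elsewhere.\<close>
  proof (rule inv_into_f_eq[OF \<Phi>_inj])
    show "(\<lambda>n. q i n (\<alpha> n)) \<in> carrier V" using lmod_homD(1)[OF comq[OF i] \<alpha>] .
    show "\<Phi> (\<lambda>n. q i n (\<alpha> n)) = (\<lambda>j\<in>I. if j = i then \<alpha> else \<zero>\<^bsub>Y j\<^esub>)"
      unfolding \<Phi>_def using \<alpha> i using Y_carr[of \<alpha> i] by (intro restrict_ext ext) (auto simp: Y_def pq)
  qed
qed

subsection \<open>Cohomology of cochain complexes\<close>

text \<open>Abstract cochain complexes separate the formal passage to cohomology from the Hom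
  complexes. Here \<open>D n\<close> raises the degree by one, whereas the differential of a complex
  P lowers it.\<close>

definition cocycle_set :: "(int \<Rightarrow> ('a, 'c) module) \<Rightarrow> (int \<Rightarrow> 'c \<Rightarrow> 'c) \<Rightarrow> int \<Rightarrow> 'c set"
  where "cocycle_set C D n = {x \<in> carrier (C n). D n x = \<zero>\<^bsub>C (n + 1)\<^esub>}"

definition coboundary_set :: "(int \<Rightarrow> ('a, 'c) module) \<Rightarrow> (int \<Rightarrow> 'c \<Rightarrow> 'c) \<Rightarrow> int \<Rightarrow> 'c set"
  where "coboundary_set C D n = D (n - 1) ` carrier (C (n - 1))"

text \<open>This has the shape of \<open>tate_degree\<close>: the record update shrinks the carrier
  to the cocycles and keeps the operations of \<open>C n\<close>. In the same way
  \<open>cohomology_map\<close> copies the union in \<open>tate_map\<close>.\<close>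

definition cohomology :: "(int \<Rightarrow> ('a, 'c) module) \<Rightarrow> (int \<Rightarrow> 'c \<Rightarrow> 'c) \<Rightarrow> int \<Rightarrow> ('a, 'c set) module"
  where "cohomology C D n =
    quotient_module ((C n)\<lparr>carrier := cocycle_set C D n\<rparr>) (coboundary_set C D n)"

definition cohomology_map ::
    "(int \<Rightarrow> ('a, 'c) module) \<Rightarrow> (int \<Rightarrow> 'c \<Rightarrow> 'c) \<Rightarrow> (int \<Rightarrow> 'b \<Rightarrow> 'c) \<Rightarrow> int \<Rightarrow> 'b set \<Rightarrow> 'c set"
  where "cohomology_map C D F n K = (\<Union>x\<in>K. coboundary_set C D n +>\<^bsub>C n\<^esub> F n x)"

text \<open>A right coset involves only the addition of the record, so it is the same set among the
  cocycles as among all cochains.\<close>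

lemma coset_carrier_update [simp]: "B +>\<^bsub>M\<lparr>carrier := Z\<rparr>\<^esub> x = B +>\<^bsub>M\<^esub> x"
  by (simp add: a_r_coset_def')

locale cochain_complex =
  fixes R :: "('a, 'e) ring_scheme" and C :: "int \<Rightarrow> ('a, 'c) module" and D :: "int \<Rightarrow> 'c \<Rightarrow> 'c"
  assumes module: "module R (C n)"
    and D_hom: "D n \<in> lmod_hom R (C n) (C (n + 1))"
    and D_D: "x \<in> carrier (C n) \<Longrightarrow> D (n + 1) (D n x) = \<zero>\<^bsub>C (n + 1 + 1)\<^esub>"
begin

lemma R_cring: "cring R"
  using module module_def by blast

lemma cocycle_submodule: "submodule (cocycle_set C D n) R (C n)"
proof -
  interpret M: module R "C n" by (rule module)
  interpret N: module R "C (n + 1)" by (rule module)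
  interpret D: abelian_group_hom "C n" "C (n + 1)" "D n"
    by (intro lmod_hom_abelian_group_hom[OF D_hom] M.abelian_group_axioms N.abelian_group_axioms)
  show ?thesis
    by (rule M.submoduleI) (auto simp: cocycle_set_def lmod_homD[OF D_hom] N.M.add.inv_one)
qed

lemma coboundary_quotient:
  "module_quotient R ((C n)\<lparr>carrier := cocycle_set C D n\<rparr>) (coboundary_set C D n)"
proof -
  interpret M: module R "C n" by (rule module)
  interpret N: module R "C (n - 1)" by (rule module)
  have D: "D (n - 1) \<in> lmod_hom R (C (n - 1)) (C n)" using D_hom[of "n - 1"] by simp
  interpret D: abelian_group_hom "C (n - 1)" "C n" "D (n - 1)"
    by (intro lmod_hom_abelian_group_hom[OF D] M.abelian_group_axioms N.abelian_group_axioms)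
  let ?Z = "(C n)\<lparr>carrier := cocycle_set C D n\<rparr>"
  interpret Z: module R ?Z
    by (rule submodule.submodule_is_module[OF cocycle_submodule M.module_axioms])
  have sub: "coboundary_set C D n \<subseteq> cocycle_set C D n"
    using D_D[of _ "n - 1"] lmod_homD(1)[OF D] by (auto simp: coboundary_set_def cocycle_set_def)
  have "submodule (coboundary_set C D n) R ?Z"
  proof (rule Z.submoduleI)
    have zero: "D (n - 1) \<zero>\<^bsub>C (n - 1)\<^esub> = \<zero>\<^bsub>C n\<^esub>" by simp
    then show "\<zero>\<^bsub>?Z\<^esub> \<in> coboundary_set C D n"
      unfolding coboundary_set_def using imageI[OF N.M.zero_closed, of "D (n - 1)"] by simp
    fix a assume a: "a \<in> coboundary_set C D n"
    then obtain x where x: "x \<in> carrier (C (n - 1))" "a = D (n - 1) x"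
      by (auto simp: coboundary_set_def)
    have mx: "D (n - 1) (\<ominus>\<^bsub>C (n - 1)\<^esub> x) \<in> coboundary_set C D n"
      using x unfolding coboundary_set_def by (intro imageI N.M.a_inv_closed)
    have "\<ominus>\<^bsub>?Z\<^esub> a = D (n - 1) (\<ominus>\<^bsub>C (n - 1)\<^esub> x)"
    \<comment> \<open>Negation in a record refers to its carrier, so the negative taken among the
      cocycles has to be identified anew, by uniqueness of inverses.\<close>
    proof (rule Z.M.minus_equality)
      show "D (n - 1) (\<ominus>\<^bsub>C (n - 1)\<^esub> x) \<oplus>\<^bsub>?Z\<^esub> a = \<zero>\<^bsub>?Z\<^esub>"
        using x by (simp add: M.l_neg)
    qed (use a mx sub in auto)
    with mx show "\<ominus>\<^bsub>?Z\<^esub> a \<in> coboundary_set C D n" by simp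
    fix b assume "b \<in> coboundary_set C D n"
    then obtain y where "y \<in> carrier (C (n - 1))" "b = D (n - 1) y"
      by (auto simp: coboundary_set_def)
    with x show "a \<oplus>\<^bsub>?Z\<^esub> b \<in> coboundary_set C D n"
      by (auto simp: coboundary_set_def lmod_homD(2)[OF D, symmetric] simp del: D.hom_add)
  next
    fix r b assume "r \<in> carrier R" "b \<in> coboundary_set C D n"
    then show "r \<odot>\<^bsub>?Z\<^esub> b \<in> coboundary_set C D n"
      by (auto simp: coboundary_set_def lmod_homD(3)[OF D, symmetric])
  qed (use sub in auto)
  then show ?thesis by (simp add: module_quotient_def module_quotient_axioms_def Z.module_axioms)
qed

lemmas module_cohomology = module_quotient.quotient_is_module[OF coboundary_quotient, folded cohomology_def]

lemma cocycle_carrier: "z \<in> cocycle_set C D n \<Longrightarrow> z \<in> carrier (C n)"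
  by (simp add: cocycle_set_def)

lemma coboundary_cocycle: "b \<in> coboundary_set C D n \<Longrightarrow> b \<in> cocycle_set C D n"
  using D_D[of _ "n - 1"] lmod_homD(1)[OF D_hom[of "n - 1"]]
  by (auto simp: coboundary_set_def cocycle_set_def)

lemma carrier_cohomology:
  "carrier (cohomology C D n) = {coboundary_set C D n +>\<^bsub>C n\<^esub> z | z. z \<in> cocycle_set C D n}"
  using module_quotient.carrier_quotient[OF coboundary_quotient[of n]] by (simp add: cohomology_def)

lemma cohomology_add:
  assumes "z \<in> cocycle_set C D n" "w \<in> cocycle_set C D n"
  shows "(coboundary_set C D n +>\<^bsub>C n\<^esub> z) \<oplus>\<^bsub>cohomology C D n\<^esub> (coboundary_set C D n +>\<^bsub>C n\<^esub> w) =
    coboundary_set C D n +>\<^bsub>C n\<^esub> (z \<oplus>\<^bsub>C n\<^esub> w)"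
  using module_quotient.quotient_add[OF coboundary_quotient[of n], of z w] assms
  by (simp add: cohomology_def)

lemma cohomology_smult:
  assumes "r \<in> carrier R" "z \<in> cocycle_set C D n"
  shows "r \<odot>\<^bsub>cohomology C D n\<^esub> (coboundary_set C D n +>\<^bsub>C n\<^esub> z) =
    coboundary_set C D n +>\<^bsub>C n\<^esub> (r \<odot>\<^bsub>C n\<^esub> z)"
  using module_quotient.quotient_smult[OF coboundary_quotient[of n], of r z] assms
  by (simp add: cohomology_def)

lemma cohomology_zero: "\<zero>\<^bsub>cohomology C D n\<^esub> = coboundary_set C D n +>\<^bsub>C n\<^esub> \<zero>\<^bsub>C n\<^esub>"
  using module_quotient.quotient_zero[OF coboundary_quotient[of n]] by (simp add: cohomology_def)

lemma class_self: "z \<in> cocycle_set C D n \<Longrightarrow> z \<in> coboundary_set C D n +>\<^bsub>C n\<^esub> z"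
proof -
  interpret module_quotient R "(C n)\<lparr>carrier := cocycle_set C D n\<rparr>" "coboundary_set C D n"
    by (rule coboundary_quotient)
  show "z \<in> cocycle_set C D n \<Longrightarrow> ?thesis" using B.a_rcos_self[of z] by simp
qed

lemma class_elim:
  assumes "y \<in> coboundary_set C D n +>\<^bsub>C n\<^esub> z"
  obtains b where "b \<in> coboundary_set C D n" "y = b \<oplus>\<^bsub>C n\<^esub> z"
  using assms by (auto simp: a_r_coset_def')

lemma class_add_coboundary:
  assumes "b \<in> coboundary_set C D n" "z \<in> cocycle_set C D n"
  shows "coboundary_set C D n +>\<^bsub>C n\<^esub> (b \<oplus>\<^bsub>C n\<^esub> z) = coboundary_set C D n +>\<^bsub>C n\<^esub> z"
  using module_quotient.add_coset_eq[OF coboundary_quotient assms(1)] assms(2) by simp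

lemma class_eq_zero_iff:
  assumes "z \<in> cocycle_set C D n"
  shows "coboundary_set C D n +>\<^bsub>C n\<^esub> z = \<zero>\<^bsub>cohomology C D n\<^esub> \<longleftrightarrow> z \<in> coboundary_set C D n"
proof -
  interpret module R "C n" by (rule module)
  interpret Q: module_quotient R "(C n)\<lparr>carrier := cocycle_set C D n\<rparr>" "coboundary_set C D n"
    by (rule coboundary_quotient)
  have *: "b \<oplus>\<^bsub>C n\<^esub> \<zero>\<^bsub>C n\<^esub> = b" if "b \<in> coboundary_set C D n" for b
    using that coboundary_cocycle cocycle_carrier by auto
  have z: "\<zero>\<^bsub>C n\<^esub> \<in> cocycle_set C D n" using Q.M.zero_closed by simp
  show ?thesis unfolding cohomology_zero
  proof
    assume "coboundary_set C D n +>\<^bsub>C n\<^esub> z = coboundary_set C D n +>\<^bsub>C n\<^esub> \<zero>\<^bsub>C n\<^esub>"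
    then have "z \<in> coboundary_set C D n +>\<^bsub>C n\<^esub> \<zero>\<^bsub>C n\<^esub>" using class_self[OF assms] by simp
    then show "z \<in> coboundary_set C D n" using * by (auto elim!: class_elim)
  next
    assume "z \<in> coboundary_set C D n"
    then show "coboundary_set C D n +>\<^bsub>C n\<^esub> z = coboundary_set C D n +>\<^bsub>C n\<^esub> \<zero>\<^bsub>C n\<^esub>"
      using class_add_coboundary[OF _ z] * by metis
  qed
qed

end

section \<open>Cochain maps and the maps they induce\<close>

locale cochain_map = C: cochain_complex R C D + C': cochain_complex R C' D'
  for R :: "('a, 'e) ring_scheme" and C :: "int \<Rightarrow> ('a, 'c) module" and D
    and C' :: "int \<Rightarrow> ('a, 'd) module" and D' +
  fixes F :: "int \<Rightarrow> 'c \<Rightarrow> 'd"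
  assumes F_hom: "F n \<in> lmod_hom R (C n) (C' n)"
    and F_D: "x \<in> carrier (C n) \<Longrightarrow> F (n + 1) (D n x) = D' n (F n x)"
begin

lemma F_cocycle:
  assumes "z \<in> cocycle_set C D n"
  shows "F n z \<in> cocycle_set C' D' n"
  using assms F_D[of z n] lmod_hom_zero[OF F_hom[of "n + 1"] C.module C'.module] lmod_homD(1)[OF F_hom]
  by (simp add: cocycle_set_def)

lemma F_coboundary:
  assumes "b \<in> coboundary_set C D n"
  shows "F n b \<in> coboundary_set C' D' n"
  using assms F_D[of _ "n - 1"] lmod_homD(1)[OF F_hom[of "n - 1"]]
  by (auto simp: coboundary_set_def)

text \<open>Representatives of one class differ by a coboundary, which \<open>F\<close> sends to a
  coboundary. Hence all cosets in the union defining \<open>cohomology_map\<close> coincide.\<close>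

lemma cohomology_map_class:
  assumes z: "z \<in> cocycle_set C D n"
  shows "cohomology_map C' D' F n (coboundary_set C D n +>\<^bsub>C n\<^esub> z) =
    coboundary_set C' D' n +>\<^bsub>C' n\<^esub> F n z"
  unfolding cohomology_map_def
proof (rule SUP_eq_const)
  fix y assume "y \<in> coboundary_set C D n +>\<^bsub>C n\<^esub> z"
  then obtain b where b: "b \<in> coboundary_set C D n" "y = b \<oplus>\<^bsub>C n\<^esub> z" by (rule C.class_elim)
  then have "F n y = F n b \<oplus>\<^bsub>C' n\<^esub> F n z"
    using lmod_homD(2)[OF F_hom] z C.coboundary_cocycle[OF b(1)] C.cocycle_carrier by blast
  then show "coboundary_set C' D' n +>\<^bsub>C' n\<^esub> F n y = coboundary_set C' D' n +>\<^bsub>C' n\<^esub> F n z"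
    using C'.class_add_coboundary[OF F_coboundary[OF b(1)] F_cocycle[OF z]] by simp
qed (use C.class_self[OF z] in blast)

lemma cohomology_map_hom:
  "cohomology_map C' D' F n \<in> lmod_hom R (cohomology C D n) (cohomology C' D' n)"
proof (rule lmod_homI)
  note sub = C.cocycle_submodule[of n]
  have add: "z \<oplus>\<^bsub>C n\<^esub> w \<in> cocycle_set C D n" if "z \<in> cocycle_set C D n" "w \<in> cocycle_set C D n" for z w
    using module.submoduleE(5)[OF C.module sub that] .
  have smult: "r \<odot>\<^bsub>C n\<^esub> z \<in> cocycle_set C D n" if "r \<in> carrier R" "z \<in> cocycle_set C D n" for r z
    using module.submoduleE(4)[OF C.module sub that] .
  show "cohomology_map C' D' F n x \<in> carrier (cohomology C' D' n)"
    if "x \<in> carrier (cohomology C D n)" for x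
    using that F_cocycle by (auto simp: C.carrier_cohomology C'.carrier_cohomology cohomology_map_class)
  show "cohomology_map C' D' F n (x \<oplus>\<^bsub>cohomology C D n\<^esub> y) =
      cohomology_map C' D' F n x \<oplus>\<^bsub>cohomology C' D' n\<^esub> cohomology_map C' D' F n y"
    if "x \<in> carrier (cohomology C D n)" "y \<in> carrier (cohomology C D n)" for x y
    using that F_cocycle C.cocycle_carrier add
    by (auto simp: C.carrier_cohomology C.cohomology_add C'.cohomology_add cohomology_map_class
        lmod_homD(2)[OF F_hom])
  show "cohomology_map C' D' F n (r \<odot>\<^bsub>cohomology C D n\<^esub> x) =
      r \<odot>\<^bsub>cohomology C' D' n\<^esub> cohomology_map C' D' F n x"
    if "r \<in> carrier R" "x \<in> carrier (cohomology C D n)" for r x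
    using that F_cocycle C.cocycle_carrier smult
    by (auto simp: C.carrier_cohomology C.cohomology_smult C'.cohomology_smult cohomology_map_class
        lmod_homD(3)[OF F_hom])
qed

end

lemma cochain_map_compose:
  assumes F: "cochain_map R C D C' D' F" and G: "cochain_map R C' D' C'' D'' G"
  shows "cochain_map R C D C'' D'' (\<lambda>n y. G n (F n y))"
proof -
  interpret F: cochain_map R C D C' D' F by fact
  interpret G: cochain_map R C' D' C'' D'' G by fact
  show ?thesis
  proof unfold_locales
    show "(\<lambda>y. G n (F n y)) \<in> lmod_hom R (C n) (C'' n)" for n
      by (rule lmod_homI) (simp_all add: lmod_homD[OF F.F_hom] lmod_homD[OF G.F_hom])
    show "G (n + 1) (F (n + 1) (D n y)) = D'' n (G n (F n y))" if "y \<in> carrier (C n)" for n y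
      using that by (simp add: F.F_D G.F_D lmod_homD[OF F.F_hom])
  qed
qed

text \<open>Functoriality lets \<pi> after restriction, and corestriction after \<theta>, be treated
  as the map induced by a single cochain map. Membership of \<open>x\<close> provides a cocycle
  representing it, on which both sides can be evaluated.\<close>

lemma cohomology_map_compose:
  assumes F: "cochain_map R C D C' D' F" and G: "cochain_map R C' D' C'' D'' G"
    and x: "x \<in> carrier (cohomology C D n)"
  shows "cohomology_map C'' D'' G n (cohomology_map C' D' F n x) =
    cohomology_map C'' D'' (\<lambda>n y. G n (F n y)) n x"
proof -
  interpret F: cochain_map R C D C' D' F by fact
  interpret G: cochain_map R C' D' C'' D'' G by fact
  interpret GF: cochain_map R C D C'' D'' "\<lambda>n y. G n (F n y)" by (rule cochain_map_compose[OF F G])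
  obtain z where "z \<in> cocycle_set C D n" "x = coboundary_set C D n +>\<^bsub>C n\<^esub> z"
    using x by (auto simp: F.C.carrier_cohomology)
  then show ?thesis
    by (simp add: F.cohomology_map_class G.cohomology_map_class GF.cohomology_map_class F.F_cocycle)
qed

text \<open>Only injectivity is not formal: if every \<open>p i\<close> sends the cocycle \<open>z\<close> to a coboundary \<open>D (c i)\<close>,
  then \<open>z\<close> and \<open>D (\<Sum>i. q i (c i))\<close> have the same images, so they are equal.\<close>

theorem cohomology_graded_iso_direct_sum:
  fixes C :: "int \<Rightarrow> ('a, 'c) module" and E :: "'i \<Rightarrow> int \<Rightarrow> ('a, 'd) module"
  assumes I: "finite I" and C: "cochain_complex R C D"
    and p: "\<And>i. i \<in> I \<Longrightarrow> cochain_map R C D (E i) (D' i) (p i)"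
    and q: "\<And>i. i \<in> I \<Longrightarrow> cochain_map R (E i) (D' i) C D (q i)"
    and pq: "\<And>i j n x. \<lbrakk>i \<in> I; j \<in> I; x \<in> carrier (E i n)\<rbrakk> \<Longrightarrow>
      p j n (q i n x) = (if j = i then x else \<zero>\<^bsub>E j n\<^esub>)"
    and inj: "\<And>n x. \<lbrakk>x \<in> carrier (C n); \<And>i. i \<in> I \<Longrightarrow> p i n x = \<zero>\<^bsub>E i n\<^esub>\<rbrakk> \<Longrightarrow> x = \<zero>\<^bsub>C n\<^esub>"
  defines "M \<equiv> cohomology C D" and "N \<equiv> \<lambda>i. cohomology (E i) (D' i)"
  defines "V \<equiv> direct_sum UNIV M" and "Y \<equiv> \<lambda>i. direct_sum UNIV (N i)"
  defines "S \<equiv> direct_sum I Y"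
    and "\<Phi> \<equiv> \<lambda>\<zeta>. \<lambda>i\<in>I. \<lambda>n. cohomology_map (E i) (D' i) (p i) n (\<zeta> n)"
  shows "graded_iso R V (\<lambda>n. {\<zeta> \<in> carrier V. \<forall>m. m \<noteq> n \<longrightarrow> \<zeta> m = \<zero>\<^bsub>M m\<^esub>}) S
      (\<lambda>n. {x \<in> carrier S. \<forall>i\<in>I. x i \<in> {\<zeta> \<in> carrier (Y i). \<forall>m. m \<noteq> n \<longrightarrow> \<zeta> m = \<zero>\<^bsub>N i m\<^esub>}}) \<Phi>"
      (is ?iso)
    and "\<lbrakk>i \<in> I; \<alpha> \<in> carrier (Y i)\<rbrakk> \<Longrightarrow>
      inv_into (carrier V) \<Phi> (\<lambda>j\<in>I. if j = i then \<alpha> else \<zero>\<^bsub>Y j\<^esub>) =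
        (\<lambda>n. cohomology_map C D (q i) n (\<alpha> n))"
proof -
  interpret C: cochain_complex R C D by (rule C)
  note E = cochain_map.axioms(2)[OF p]
  \<comment> \<open>An identity between cochain maps passes to classes by evaluation on a cocycle
    representative.\<close>
  have pq': "cohomology_map (E j) (D' j) (p j) n (cohomology_map C D (q i) n x) =
      (if j = i then x else \<zero>\<^bsub>N j n\<^esub>)" if ij: "i \<in> I" "j \<in> I" and x: "x \<in> carrier (N i n)" for i j n x
  proof -
    interpret q: cochain_map R "E i" "D' i" C D "q i" by (rule q[OF ij(1)])
    interpret p: cochain_map R C D "E j" "D' j" "p j" by (rule p[OF ij(2)])
    obtain z where z: "z \<in> cocycle_set (E i) (D' i) n"
        "x = coboundary_set (E i) (D' i) n +>\<^bsub>E i n\<^esub> z"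
      using x by (auto simp: N_def q.C.carrier_cohomology)
    then show ?thesis
      using pq[OF ij q.C.cocycle_carrier[OF z(1)]]
      by (auto simp: q.cohomology_map_class p.cohomology_map_class q.F_cocycle N_def p.C'.cohomology_zero)
  qed
  have inj': "x = \<zero>\<^bsub>M n\<^esub>" if x: "x \<in> carrier (M n)"
    and 0: "\<And>i. i \<in> I \<Longrightarrow> cohomology_map (E i) (D' i) (p i) n x = \<zero>\<^bsub>N i n\<^esub>" for n x
  proof -
    obtain z where z: "z \<in> cocycle_set C D n" "x = coboundary_set C D n +>\<^bsub>C n\<^esub> z"
      using x by (auto simp: M_def C.carrier_cohomology)
    have "\<exists>c\<in>carrier (E i (n - 1)). p i n z = D' i (n - 1) c" if i: "i \<in> I" for i
    proof -
      interpret p: cochain_map R C D "E i" "D' i" "p i" by (rule p[OF i])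
      have "p i n z \<in> coboundary_set (E i) (D' i) n"
        using 0[OF i] z p.F_cocycle[OF z(1)]
        by (simp add: p.cohomology_map_class N_def p.C'.class_eq_zero_iff)
      then show ?thesis by (auto simp: coboundary_set_def)
    qed
    then obtain c where c: "\<And>i. i \<in> I \<Longrightarrow> c i \<in> carrier (E i (n - 1))"
        "\<And>i. i \<in> I \<Longrightarrow> p i n z = D' i (n - 1) (c i)"
      by metis
    interpret M: module R "C n" by (rule C.module)
    interpret M': module R "C (n - 1)" by (rule C.module)
    have qc: "(\<lambda>i. q i (n - 1) (c i)) \<in> I \<rightarrow> carrier (C (n - 1))"
      using c(1) lmod_homD(1)[OF cochain_map.F_hom[OF q]] by blast
    define w where "w = (\<Oplus>\<^bsub>C (n - 1)\<^esub>i\<in>I. q i (n - 1) (c i))"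
    have w: "w \<in> carrier (C (n - 1))" unfolding w_def by (rule M'.finsum_closed[OF qc])
    have Dw: "D (n - 1) w \<in> carrier (C n)" using lmod_homD(1)[OF C.D_hom w] by simp
    \<comment> \<open>The relations \<open>pq\<close>, used in degree n - 1, recover c_j from w; p_j
      then carries D w to D' c_j, which is p_j z.\<close>
    have pw: "p j (n - 1) w = c j" if j: "j \<in> I" for j
    proof -
      interpret p: cochain_map R C D "E j" "D' j" "p j" by (rule p[OF j])
      interpret N: module R "E j (n - 1)" by (rule p.C'.module)
      interpret h: abelian_group_hom "C (n - 1)" "E j (n - 1)" "p j (n - 1)"
        by (intro lmod_hom_abelian_group_hom[OF p.F_hom] M'.abelian_group_axioms N.abelian_group_axioms)
      have "p j (n - 1) w = (\<Oplus>\<^bsub>E j (n - 1)\<^esub>i\<in>I. p j (n - 1) (q i (n - 1) (c i)))"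
        unfolding w_def by (rule h.hom_finsum[OF qc])
      also have "\<dots> = (\<Oplus>\<^bsub>E j (n - 1)\<^esub>i\<in>I. if j = i then c j else \<zero>\<^bsub>E j (n - 1)\<^esub>)"
        using j c(1) by (intro N.M.finsum_cong') (auto simp: pq)
      also have "\<dots> = c j"
        using N.M.finsum_singleton[OF j I, of "\<lambda>_. c j"] c(1)[OF j] by simp
      finally show ?thesis .
    qed
    have "z \<ominus>\<^bsub>C n\<^esub> D (n - 1) w = \<zero>\<^bsub>C n\<^esub>"
    proof (rule inj)
      show "z \<ominus>\<^bsub>C n\<^esub> D (n - 1) w \<in> carrier (C n)" using C.cocycle_carrier[OF z(1)] Dw by simp
      fix i assume i: "i \<in> I"
      interpret p: cochain_map R C D "E i" "D' i" "p i" by (rule p[OF i])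
      interpret N: module R "E i n" by (rule p.C'.module)
      interpret h: abelian_group_hom "C n" "E i n" "p i n"
        by (intro lmod_hom_abelian_group_hom[OF p.F_hom] M.abelian_group_axioms N.abelian_group_axioms)
      have "p i n (D (n - 1) w) = p i n z"
        using p.F_D[OF w] pw[OF i] c(2)[OF i] by simp
      then show "p i n (z \<ominus>\<^bsub>C n\<^esub> D (n - 1) w) = \<zero>\<^bsub>E i n\<^esub>"
        using h.hom_minus[OF C.cocycle_carrier[OF z(1)] Dw] C.cocycle_carrier[OF z(1)]
        by (simp add: N.M.r_neg a_minus_def)
    qed
    then have "z = D (n - 1) w"
      using minus_eq_zero_iff[OF M.abelian_group_axioms C.cocycle_carrier[OF z(1)] Dw] by simp
    then have "z \<in> coboundary_set C D n" using w by (auto simp: coboundary_set_def)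
    then show ?thesis using C.class_eq_zero_iff[OF z(1)] z(2) by (simp add: M_def)
  qed
  have prem: "module R (M n)" "i \<in> I \<Longrightarrow> module R (N i n)"
    "i \<in> I \<Longrightarrow> cohomology_map (E i) (D' i) (p i) n \<in> lmod_hom R (M n) (N i n)"
    "i \<in> I \<Longrightarrow> cohomology_map C D (q i) n \<in> lmod_hom R (N i n) (M n)" for i n
    using C.module_cohomology cochain_complex.module_cohomology[OF E]
      cochain_map.cohomology_map_hom[OF p] cochain_map.cohomology_map_hom[OF q]
    by (auto simp: M_def N_def)
  note iso = graded_iso_direct_sum[where M = M and N = N
      and q = "\<lambda>i. cohomology_map C D (q i)" and p = "\<lambda>i. cohomology_map (E i) (D' i) (p i)"]
  show ?iso
    unfolding V_def S_def Y_def \<Phi>_def by (rule iso(1)) (fact I C.R_cring prem pq' inj')+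
  show "inv_into (carrier V) \<Phi> (\<lambda>j\<in>I. if j = i then \<alpha> else \<zero>\<^bsub>Y j\<^esub>) =
      (\<lambda>n. cohomology_map C D (q i) n (\<alpha> n))" if "i \<in> I" "\<alpha> \<in> carrier (Y i)"
    unfolding V_def S_def Y_def \<Phi>_def
    by (rule iso(2)) (fact I C.R_cring prem pq' inj' that[unfolded Y_def])+
qed

subsection \<open>Modules over the group ring\<close>

text \<open>The axioms of a module over \<open>RH\<close>, expressed by the elements \<open>r h\<close> alone.\<close>

locale group_rep = R: cring R + H: group H + N: abelian_group N
  for R :: "('r, 'e) ring_scheme" and H :: "('h, 'k) monoid_scheme"
    and N :: "('h \<Rightarrow> 'r, 'n) module" +
  assumes finite_group: "finite (carrier H)"
    and act_closed [simp]: "\<lbrakk>h \<in> carrier H; r \<in> carrier R; x \<in> carrier N\<rbrakk> \<Longrightarrow>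
      gr_single R h r \<odot>\<^bsub>N\<^esub> x \<in> carrier N"
    and act_add: "\<lbrakk>h \<in> carrier H; r \<in> carrier R; x \<in> carrier N; y \<in> carrier N\<rbrakk> \<Longrightarrow>
      gr_single R h r \<odot>\<^bsub>N\<^esub> (x \<oplus>\<^bsub>N\<^esub> y) = gr_single R h r \<odot>\<^bsub>N\<^esub> x \<oplus>\<^bsub>N\<^esub> gr_single R h r \<odot>\<^bsub>N\<^esub> y"
    and act_radd: "\<lbrakk>h \<in> carrier H; r \<in> carrier R; s \<in> carrier R; x \<in> carrier N\<rbrakk> \<Longrightarrow>
      gr_single R h (r \<oplus>\<^bsub>R\<^esub> s) \<odot>\<^bsub>N\<^esub> x = gr_single R h r \<odot>\<^bsub>N\<^esub> x \<oplus>\<^bsub>N\<^esub> gr_single R h s \<odot>\<^bsub>N\<^esub> x"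
    and act_mult: "\<lbrakk>h \<in> carrier H; r \<in> carrier R; k \<in> carrier H; s \<in> carrier R; x \<in> carrier N\<rbrakk> \<Longrightarrow>
      gr_single R h r \<odot>\<^bsub>N\<^esub> (gr_single R k s \<odot>\<^bsub>N\<^esub> x) =
      gr_single R (h \<otimes>\<^bsub>H\<^esub> k) (r \<otimes>\<^bsub>R\<^esub> s) \<odot>\<^bsub>N\<^esub> x"
    and act_one: "x \<in> carrier N \<Longrightarrow> gr_single R \<one>\<^bsub>H\<^esub> \<one>\<^bsub>R\<^esub> \<odot>\<^bsub>N\<^esub> x = x"
    and act_expand: "\<lbrakk>a \<in> carrier (group_ring R H); x \<in> carrier N\<rbrakk> \<Longrightarrow>
      a \<odot>\<^bsub>N\<^esub> x = (\<Oplus>\<^bsub>N\<^esub>h\<in>carrier H. gr_single R h (a h) \<odot>\<^bsub>N\<^esub> x)"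
begin

lemma act_zero [simp]:
  assumes "h \<in> carrier H" "x \<in> carrier N"
  shows "gr_single R h \<zero>\<^bsub>R\<^esub> \<odot>\<^bsub>N\<^esub> x = \<zero>\<^bsub>N\<^esub>"
proof -
  have "gr_single R h \<zero>\<^bsub>R\<^esub> \<odot>\<^bsub>N\<^esub> x \<oplus>\<^bsub>N\<^esub> gr_single R h \<zero>\<^bsub>R\<^esub> \<odot>\<^bsub>N\<^esub> x = gr_single R h \<zero>\<^bsub>R\<^esub> \<odot>\<^bsub>N\<^esub> x"
    using act_radd[OF assms(1) R.zero_closed R.zero_closed assms(2)] by simp
  then show ?thesis using assms by (simp add: N.add.l_cancel_one)
qed

lemma act_hom:
  assumes "h \<in> carrier H" "r \<in> carrier R"
  shows "abelian_group_hom N N (\<lambda>x. gr_single R h r \<odot>\<^bsub>N\<^esub> x)"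
  using assms by (intro abelian_group_hom_additiveI N.abelian_group_axioms) (auto simp: act_add)

lemma act_zero_right [simp]:
  assumes "h \<in> carrier H" "r \<in> carrier R"
  shows "gr_single R h r \<odot>\<^bsub>N\<^esub> \<zero>\<^bsub>N\<^esub> = \<zero>\<^bsub>N\<^esub>"
  using abelian_group_hom.hom_zero[OF act_hom[OF assms]] .

text \<open>Commutativity of R makes the action of s at the identity of H commute with every r h.
  This is what keeps scalar multiples of cochains equivariant and makes corestriction
  R-linear.\<close>

lemma scalar_commute:
  assumes "h \<in> carrier H" "r \<in> carrier R" "s \<in> carrier R" "x \<in> carrier N"
  shows "gr_single R \<one>\<^bsub>H\<^esub> s \<odot>\<^bsub>N\<^esub> (gr_single R h r \<odot>\<^bsub>N\<^esub> x) = gr_single R h r \<odot>\<^bsub>N\<^esub> (gr_single R \<one>\<^bsub>H\<^esub> s \<odot>\<^bsub>N\<^esub> x)"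
  using assms by (simp add: act_mult R.m_comm)

end

section \<open>Linearity over the group ring of a subgroup\<close>

lemma gr_single_carrier:
  assumes "cring R" "h \<in> carrier K" "r \<in> carrier R"
  shows "gr_single R h r \<in> carrier (group_ring R K)"
proof -
  interpret cring R by fact
  show ?thesis using assms by (auto simp: gr_single_def group_ring_def)
qed

text \<open>An element of RL is also an element of RH, so \<open>act_expand\<close> writes its
  action as a sum over all of H. For h outside \<open>L\<close> the coefficient is zero and the
  terms on both sides vanish; for h in \<open>L\<close> the assumption on r h applies.\<close>

lemma lmod_hom_group_ringI:
  assumes M: "group_rep R H M" and N: "group_rep R H N" and L: "L \<subseteq> carrier H"
    and closed: "\<And>x. x \<in> carrier M \<Longrightarrow> f x \<in> carrier N"
    and add: "\<And>x y. \<lbrakk>x \<in> carrier M; y \<in> carrier M\<rbrakk> \<Longrightarrow> f (x \<oplus>\<^bsub>M\<^esub> y) = f x \<oplus>\<^bsub>N\<^esub> f y"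
    and act: "\<And>h r x. \<lbrakk>h \<in> L; r \<in> carrier R; x \<in> carrier M\<rbrakk> \<Longrightarrow>
      f (gr_single R h r \<odot>\<^bsub>M\<^esub> x) = gr_single R h r \<odot>\<^bsub>N\<^esub> f x"
  shows "f \<in> lmod_hom (group_ring R (H\<lparr>carrier := L\<rparr>)) M N"
proof (rule lmod_homI[OF closed add])
  interpret M: group_rep R H M by fact
  interpret N: group_rep R H N by fact
  interpret f: abelian_group_hom M N f
    using closed add
    by (intro abelian_group_hom_additiveI M.N.abelian_group_axioms N.N.abelian_group_axioms)
  fix a x assume a: "a \<in> carrier (group_ring R (H\<lparr>carrier := L\<rparr>))" and x: "x \<in> carrier M"
  have aL: "a h \<in> carrier R" if "h \<in> L" for h using a that by (simp add: group_ring_def)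
  have a0: "a h = \<zero>\<^bsub>R\<^esub>" if "h \<notin> L" for h using a that by (simp add: group_ring_def)
  have aR: "a h \<in> carrier R" for h using aL a0 M.R.zero_closed by (cases "h \<in> L") auto
  have aH: "a \<in> carrier (group_ring R H)" using aR a0 L by (auto simp: group_ring_def)
  have "f (a \<odot>\<^bsub>M\<^esub> x) = (\<Oplus>\<^bsub>N\<^esub>h\<in>carrier H. f (gr_single R h (a h) \<odot>\<^bsub>M\<^esub> x))"
    using x aR by (simp add: M.act_expand[OF aH] f.hom_finsum)
  also have "\<dots> = (\<Oplus>\<^bsub>N\<^esub>h\<in>carrier H. gr_single R h (a h) \<odot>\<^bsub>N\<^esub> f x)"
  proof (rule N.N.finsum_cong')
    show "f (gr_single R h (a h) \<odot>\<^bsub>M\<^esub> x) = gr_single R h (a h) \<odot>\<^bsub>N\<^esub> f x" if "h \<in> carrier H" for h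
      using that x aR act closed by (cases "h \<in> L") (auto simp: a0)
  qed (use x aR closed in auto)
  also have "\<dots> = a \<odot>\<^bsub>N\<^esub> f x" using N.act_expand[OF aH] closed x by simp
  finally show "f (a \<odot>\<^bsub>M\<^esub> x) = a \<odot>\<^bsub>N\<^esub> f x" .
qed auto

lemma lmod_hom_group_ring_act:
  assumes "cring R" "f \<in> lmod_hom (group_ring R (H\<lparr>carrier := L\<rparr>)) M N"
    and "h \<in> L" "r \<in> carrier R" "x \<in> carrier M"
  shows "f (gr_single R h r \<odot>\<^bsub>M\<^esub> x) = gr_single R h r \<odot>\<^bsub>N\<^esub> f x"
  using lmod_homD(3)[OF assms(2)] gr_single_carrier[OF assms(1), of h "H\<lparr>carrier := L\<rparr>" r] assms(3-)
  by simp

text \<open>Two facts inside RH suffice: the elements r h multiply as scalars and group elements do,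
  and every a is the finite sum of its terms a_h h. The module axioms carry both over to M.\<close>

lemma group_rep_left_module:
  assumes R: "cring R" and H: "group H" "finite (carrier H)"
    and M: "left_module (group_ring R H) M"
  shows "group_rep R H M"
proof -
  interpret R: cring R by fact
  interpret H: group H by fact
  interpret M: left_module "group_ring R H" M by fact
  note single = gr_single_carrier[OF R, of _ H]
  have add: "gr_single R h (r \<oplus>\<^bsub>R\<^esub> s) = gr_single R h r \<oplus>\<^bsub>group_ring R H\<^esub> gr_single R h s"
    if "h \<in> carrier H" "r \<in> carrier R" "s \<in> carrier R" for h r s
    using that by (auto simp: gr_single_def group_ring_def fun_eq_iff)
  have mult: "gr_single R h r \<otimes>\<^bsub>group_ring R H\<^esub> gr_single R k s = gr_single R (h \<otimes>\<^bsub>H\<^esub> k) (r \<otimes>\<^bsub>R\<^esub> s)"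
    if hk: "h \<in> carrier H" "k \<in> carrier H" "r \<in> carrier R" "s \<in> carrier R" for h k r s
  proof
    fix x
    let ?A = "{(y, z). y \<in> carrier H \<and> z \<in> carrier H \<and> y \<otimes>\<^bsub>H\<^esub> z = x}"
    have "?A \<subseteq> carrier H \<times> carrier H" by auto
    then have fin: "finite ?A" using H(2) finite_subset by blast
    have "(gr_single R h r \<otimes>\<^bsub>group_ring R H\<^esub> gr_single R k s) x =
        (\<Oplus>\<^bsub>R\<^esub>w\<in>?A. if (h, k) = w then r \<otimes>\<^bsub>R\<^esub> s else \<zero>\<^bsub>R\<^esub>)"
      unfolding group_ring_def using that
      by (auto simp: gr_single_def intro!: R.finsum_cong')
    \<comment> \<open>The pair (h, k) is a summation index exactly when x = h k, and no other index
      contributes.\<close>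
    also have "\<dots> = gr_single R (h \<otimes>\<^bsub>H\<^esub> k) (r \<otimes>\<^bsub>R\<^esub> s) x"
    proof (cases "(h, k) \<in> ?A")
      case True
      then show ?thesis
        using R.finsum_singleton[OF True fin, of "\<lambda>_. r \<otimes>\<^bsub>R\<^esub> s"] hk by (auto simp: gr_single_def)
    next
      case False
      have "(\<Oplus>\<^bsub>R\<^esub>w\<in>?A. if (h, k) = w then r \<otimes>\<^bsub>R\<^esub> s else \<zero>\<^bsub>R\<^esub>) = (\<Oplus>\<^bsub>R\<^esub>w\<in>?A. \<zero>\<^bsub>R\<^esub>)"
        using False by (intro R.finsum_cong') auto
      with False hk show ?thesis by (auto simp: gr_single_def)
    qed
    finally show "(gr_single R h r \<otimes>\<^bsub>group_ring R H\<^esub> gr_single R k s) x =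
        gr_single R (h \<otimes>\<^bsub>H\<^esub> k) (r \<otimes>\<^bsub>R\<^esub> s) x" .
  qed
  have one: "gr_single R \<one>\<^bsub>H\<^esub> \<one>\<^bsub>R\<^esub> = \<one>\<^bsub>group_ring R H\<^esub>"
    by (simp add: gr_single_def group_ring_def)
  have eval: "abelian_group_hom (group_ring R H) R (\<lambda>a. a k)" if "k \<in> carrier H" for k
    by (intro abelian_group_hom_additiveI M.A.abelian_group_axioms R.abelian_group_axioms)
      (use that in \<open>auto simp: group_ring_def\<close>)
  \<comment> \<open>Both sides are compared at each k: evaluation at an element of H is additive,
    and outside H both sides vanish.\<close>
  have expand: "a = (\<Oplus>\<^bsub>group_ring R H\<^esub>h\<in>carrier H. gr_single R h (a h))"
    if a: "a \<in> carrier (group_ring R H)" for a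
  proof
    fix k
    have aR: "a h \<in> carrier R" if "h \<in> carrier H" for h using a that by (simp add: group_ring_def)
    let ?s = "\<Oplus>\<^bsub>group_ring R H\<^esub>h\<in>carrier H. gr_single R h (a h)"
    have s: "?s \<in> carrier (group_ring R H)"
      using aR by (intro M.A.finsum_closed) (auto intro: single)
    show "a k = ?s k"
    proof (cases "k \<in> carrier H")
      case True
      have "?s k = (\<Oplus>\<^bsub>R\<^esub>h\<in>carrier H. gr_single R h (a h) k)"
        using aR by (intro abelian_group_hom.hom_finsum[OF eval[OF True]]) (auto intro: single)
      also have "\<dots> = (\<Oplus>\<^bsub>R\<^esub>h\<in>carrier H. if k = h then a k else \<zero>\<^bsub>R\<^esub>)"
        using aR by (intro R.finsum_cong') (auto simp: gr_single_def)
      also have "\<dots> = a k" using R.finsum_singleton[OF True H(2), of "\<lambda>_. a k"] aR[OF True] by simp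
      finally show ?thesis by simp
    next
      case False
      then show ?thesis using s a by (simp add: group_ring_def)
    qed
  qed
  show ?thesis
  proof unfold_locales
    show "gr_single R h r \<odot>\<^bsub>M\<^esub> (gr_single R k s \<odot>\<^bsub>M\<^esub> x) = gr_single R (h \<otimes>\<^bsub>H\<^esub> k) (r \<otimes>\<^bsub>R\<^esub> s) \<odot>\<^bsub>M\<^esub> x"
      if "h \<in> carrier H" "r \<in> carrier R" "k \<in> carrier H" "s \<in> carrier R" "x \<in> carrier M" for h r k s x
      using that by (simp add: mult[symmetric] M.smult_assoc single)
    fix a x assume a: "a \<in> carrier (group_ring R H)" and x: "x \<in> carrier M"
    interpret ev: abelian_group_hom "group_ring R H" M "\<lambda>a. a \<odot>\<^bsub>M\<^esub> x"
      using x by (intro abelian_group_hom_additiveI M.A.abelian_group_axioms M.M.abelian_group_axioms)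
        (auto simp: M.smult_closed M.smult_l_distr)
    have "a h \<in> carrier R" if "h \<in> carrier H" for h using a that by (simp add: group_ring_def)
    then have "(\<Oplus>\<^bsub>group_ring R H\<^esub>h\<in>carrier H. gr_single R h (a h)) \<odot>\<^bsub>M\<^esub> x =
        (\<Oplus>\<^bsub>M\<^esub>h\<in>carrier H. gr_single R h (a h) \<odot>\<^bsub>M\<^esub> x)"
      by (intro ev.hom_finsum) (auto intro: single)
    then show "a \<odot>\<^bsub>M\<^esub> x = (\<Oplus>\<^bsub>M\<^esub>h\<in>carrier H. gr_single R h (a h) \<odot>\<^bsub>M\<^esub> x)"
      using expand[OF a] by simp
  qed (auto simp: H M.smult_closed single M.smult_r_distr M.smult_l_distr add one M.smult_one)
qed

section \<open>The trivial module R\<close>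

lemma trivial_module_simps [simp]:
  "carrier (trivial_module R H) = carrier R" "\<zero>\<^bsub>trivial_module R H\<^esub> = \<zero>\<^bsub>R\<^esub>"
  "x \<oplus>\<^bsub>trivial_module R H\<^esub> y = x \<oplus>\<^bsub>R\<^esub> y"
  by (simp_all add: trivial_module_def)

text \<open>RH acts on R through the augmentation, and the sum of the coefficients of r h has the
  single term r.\<close>

lemma trivial_module_act:
  assumes "cring R" "finite (carrier H)" "h \<in> carrier H" "r \<in> carrier R" "x \<in> carrier R"
  shows "gr_single R h r \<odot>\<^bsub>trivial_module R H\<^esub> x = r \<otimes>\<^bsub>R\<^esub> x"
proof -
  interpret R: cring R by fact
  have "gr_single R h r \<odot>\<^bsub>trivial_module R H\<^esub> x = (\<Oplus>\<^bsub>R\<^esub>k\<in>carrier H. if h = k then r \<otimes>\<^bsub>R\<^esub> x else \<zero>\<^bsub>R\<^esub>)"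
    using assms by (auto simp: trivial_module_def gr_single_def intro!: R.finsum_cong')
  also have "\<dots> = r \<otimes>\<^bsub>R\<^esub> x"
    using R.finsum_singleton[OF assms(3,2), of "\<lambda>_. r \<otimes>\<^bsub>R\<^esub> x"] assms by simp
  finally show ?thesis .
qed

lemma abelian_group_trivial_module:
  assumes "cring R"
  shows "abelian_group (trivial_module R H)"
proof -
  interpret R: cring R by fact
  show ?thesis
    by (rule abelian_groupI) (auto simp: R.a_assoc R.a_comm R.a_lcomm intro: R.l_neg bexI[of _ "\<ominus>\<^bsub>R\<^esub> _"])
qed

lemma finsum_trivial_module: "finsum (trivial_module R H) f A = finsum R f A"
  by (simp add: finsum_def finprod_def trivial_module_def)

text \<open>The conditions are verified directly on the elements r h, which avoids proving the
  module axioms for arbitrary elements of RH first.\<close>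

lemma group_rep_trivial_module:
  assumes R: "cring R" and H: "group H" "finite (carrier H)"
  shows "group_rep R H (trivial_module R H)"
proof -
  interpret R: cring R by fact
  interpret H: group H by fact
  interpret T: abelian_group "trivial_module R H" by (rule abelian_group_trivial_module[OF R])
  note act = trivial_module_act[OF R H(2)]
  show ?thesis
  proof unfold_locales
    fix a x assume a: "a \<in> carrier (group_ring R H)" and x: "x \<in> carrier (trivial_module R H)"
    then have "a h \<in> carrier R" if "h \<in> carrier H" for h using that by (simp add: group_ring_def)
    with x show "a \<odot>\<^bsub>trivial_module R H\<^esub> x =
        (\<Oplus>\<^bsub>trivial_module R H\<^esub>h\<in>carrier H. gr_single R h (a h) \<odot>\<^bsub>trivial_module R H\<^esub> x)"
      unfolding finsum_trivial_module
      by (subst trivial_module_def) (auto simp: act intro!: R.finsum_cong')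
  qed (auto simp: H act R.l_distr R.r_distr R.m_assoc)
qed

section \<open>The permutation module RG\<close>

locale permutation_module = R: cring R + H: group H + action: group_action H "carrier G" \<phi>
  for R :: "('r, 'e) ring_scheme" and H :: "('h, 'k) monoid_scheme"
    and G :: "('g, 'l) monoid_scheme" and \<phi> :: "'h \<Rightarrow> 'g \<Rightarrow> 'g" +
  assumes finite_H: "finite (carrier H)"
begin

abbreviation RG :: "('h \<Rightarrow> 'r, 'g \<Rightarrow> 'r) module" where "RG \<equiv> action_module R H G \<phi>"

lemma carrier_RG:
  "m \<in> carrier RG \<longleftrightarrow> (\<forall>x\<in>carrier G. m x \<in> carrier R) \<and> (\<forall>x. x \<notin> carrier G \<longrightarrow> m x = \<zero>\<^bsub>R\<^esub>)"
  by (simp add: action_module_def group_ring_def)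

lemma RG_closed: "m \<in> carrier RG \<Longrightarrow> m x \<in> carrier R"
  using R.zero_closed by (cases "x \<in> carrier G") (auto simp: carrier_RG)

lemma RG_simps [simp]:
  "\<zero>\<^bsub>RG\<^esub> = (\<lambda>x. \<zero>\<^bsub>R\<^esub>)"
  "m \<oplus>\<^bsub>RG\<^esub> m' = (\<lambda>x. if x \<in> carrier G then m x \<oplus>\<^bsub>R\<^esub> m' x else \<zero>\<^bsub>R\<^esub>)"
  by (simp_all add: action_module_def group_ring_def)

lemma abelian_group_RG: "abelian_group RG"
proof (rule abelian_groupI)
  fix m assume m: "m \<in> carrier RG"
  show "\<exists>m'\<in>carrier RG. m' \<oplus>\<^bsub>RG\<^esub> m = \<zero>\<^bsub>RG\<^esub>"
    using m by (intro bexI[of _ "\<lambda>x. if x \<in> carrier G then \<ominus>\<^bsub>R\<^esub> m x else \<zero>\<^bsub>R\<^esub>"])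
      (auto simp: carrier_RG R.l_neg)
qed (auto simp: carrier_RG R.a_assoc R.a_comm R.a_lcomm fun_eq_iff)

lemma action_closed: "\<lbrakk>h \<in> carrier H; x \<in> carrier G\<rbrakk> \<Longrightarrow> \<phi> h x \<in> carrier G"
  using action.element_image by blast

lemma action_mult:
  "\<lbrakk>h \<in> carrier H; k \<in> carrier H; x \<in> carrier G\<rbrakk> \<Longrightarrow> \<phi> h (\<phi> k x) = \<phi> (h \<otimes>\<^bsub>H\<^esub> k) x"
  using action.composition_rule by simp

lemma action_one: "x \<in> carrier G \<Longrightarrow> \<phi> \<one>\<^bsub>H\<^esub> x = x"
  using action.id_eq_one by (metis restrict_apply)

lemma action_inv:
  assumes "h \<in> carrier H" "x \<in> carrier G"
  shows "\<phi> (inv\<^bsub>H\<^esub> h) (\<phi> h x) = x" "\<phi> h (\<phi> (inv\<^bsub>H\<^esub> h) x) = x"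
  using assms by (simp_all add: action_mult action_one)

text \<open>A pair (h, y) with h y = x is determined by h, because y is the translate of x by the
  inverse of h. Reindexing turns the sum over pairs into a sum over H.\<close>

lemma RG_smult:
  assumes a: "\<And>h. h \<in> carrier H \<Longrightarrow> a h \<in> carrier R" and m: "m \<in> carrier RG" and x: "x \<in> carrier G"
  shows "(a \<odot>\<^bsub>RG\<^esub> m) x = (\<Oplus>\<^bsub>R\<^esub>h\<in>carrier H. a h \<otimes>\<^bsub>R\<^esub> m (\<phi> (inv\<^bsub>H\<^esub> h) x))"
proof -
  let ?e = "\<lambda>h. (h, \<phi> (inv\<^bsub>H\<^esub> h) x)"
  have img: "{(h, g). h \<in> carrier H \<and> g \<in> carrier G \<and> \<phi> h g = x} = ?e ` carrier H"
    using x action_closed action_inv by (auto simp: image_iff)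
  have "(a \<odot>\<^bsub>RG\<^esub> m) x = (\<Oplus>\<^bsub>R\<^esub>w\<in>?e ` carrier H. a (fst w) \<otimes>\<^bsub>R\<^esub> m (snd w))"
    by (simp add: action_module_def img)
  also have "\<dots> = (\<Oplus>\<^bsub>R\<^esub>h\<in>carrier H. a h \<otimes>\<^bsub>R\<^esub> m (\<phi> (inv\<^bsub>H\<^esub> h) x))"
    using a RG_closed[OF m] by (subst R.finsum_reindex) (auto simp: inj_on_def)
  finally show ?thesis .
qed

lemma RG_smult_outside: "x \<notin> carrier G \<Longrightarrow> (a \<odot>\<^bsub>RG\<^esub> m) x = \<zero>\<^bsub>R\<^esub>"
proof -
  assume "x \<notin> carrier G"
  then have empty: "{(h, g). h \<in> carrier H \<and> g \<in> carrier G \<and> \<phi> h g = x} = {}"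
    using action_closed by auto
  have "(a \<odot>\<^bsub>RG\<^esub> m) x = (\<Oplus>\<^bsub>R\<^esub>w\<in>{(h, g). h \<in> carrier H \<and> g \<in> carrier G \<and> \<phi> h g = x}.
      a (fst w) \<otimes>\<^bsub>R\<^esub> m (snd w))"
    by (simp add: action_module_def)
  then show ?thesis unfolding empty by simp
qed

lemma RG_act:
  assumes h: "h \<in> carrier H" and r: "r \<in> carrier R" and m: "m \<in> carrier RG"
  shows "gr_single R h r \<odot>\<^bsub>RG\<^esub> m =
    (\<lambda>x. if x \<in> carrier G then r \<otimes>\<^bsub>R\<^esub> m (\<phi> (inv\<^bsub>H\<^esub> h) x) else \<zero>\<^bsub>R\<^esub>)"
proof
  fix x
  show "(gr_single R h r \<odot>\<^bsub>RG\<^esub> m) x = (if x \<in> carrier G then r \<otimes>\<^bsub>R\<^esub> m (\<phi> (inv\<^bsub>H\<^esub> h) x) else \<zero>\<^bsub>R\<^esub>)"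
  proof (cases "x \<in> carrier G")
    case True
    have "(gr_single R h r \<odot>\<^bsub>RG\<^esub> m) x =
        (\<Oplus>\<^bsub>R\<^esub>k\<in>carrier H. gr_single R h r k \<otimes>\<^bsub>R\<^esub> m (\<phi> (inv\<^bsub>H\<^esub> k) x))"
      using r by (intro RG_smult[OF _ m True]) (auto simp: gr_single_def)
    also have "\<dots> = (\<Oplus>\<^bsub>R\<^esub>k\<in>carrier H. if h = k then r \<otimes>\<^bsub>R\<^esub> m (\<phi> (inv\<^bsub>H\<^esub> h) x) else \<zero>\<^bsub>R\<^esub>)"
      using r RG_closed[OF m] by (intro R.finsum_cong') (auto simp: gr_single_def)
    also have "\<dots> = r \<otimes>\<^bsub>R\<^esub> m (\<phi> (inv\<^bsub>H\<^esub> h) x)"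
      using R.finsum_singleton[OF h finite_H, of "\<lambda>_. r \<otimes>\<^bsub>R\<^esub> m (\<phi> (inv\<^bsub>H\<^esub> h) x)"] r RG_closed[OF m] by simp
    finally show ?thesis using True by simp
  qed (simp add: RG_smult_outside)
qed

text \<open>This allows sums in RG to be computed one coefficient at a time, both for
  \<open>act_expand\<close> and for the transfer sum.\<close>

lemma RG_eval_hom:
  assumes "x \<in> carrier G"
  shows "abelian_group_hom RG R (\<lambda>m. m x)"
  using assms RG_closed
  by (intro abelian_group_hom_additiveI abelian_group_RG R.abelian_group_axioms) auto

lemma group_rep_RG: "group_rep R H RG"
proof -
  interpret RG: abelian_group RG by (rule abelian_group_RG)
  have act_closed: "gr_single R h r \<odot>\<^bsub>RG\<^esub> m \<in> carrier RG"
    if "h \<in> carrier H" "r \<in> carrier R" "m \<in> carrier RG" for h r m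
    using that RG_closed[OF that(3)] by (simp add: RG_act carrier_RG)
  show ?thesis
  proof unfold_locales
    show "gr_single R h r \<odot>\<^bsub>RG\<^esub> m \<in> carrier RG"
      if "h \<in> carrier H" "r \<in> carrier R" "m \<in> carrier RG" for h r m
      using act_closed[OF that] .
    show "gr_single R h r \<odot>\<^bsub>RG\<^esub> (gr_single R k s \<odot>\<^bsub>RG\<^esub> m) = gr_single R (h \<otimes>\<^bsub>H\<^esub> k) (r \<otimes>\<^bsub>R\<^esub> s) \<odot>\<^bsub>RG\<^esub> m"
      if "h \<in> carrier H" "r \<in> carrier R" "k \<in> carrier H" "s \<in> carrier R" "m \<in> carrier RG" for h r k s m
    proof -
      note lhs = RG_act[OF that(1,2) act_closed[OF that(3-5)]]
      show ?thesis
        unfolding lhs using that RG_closed[OF that(5)]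
        by (auto simp: RG_act fun_eq_iff action_closed action_mult H.inv_mult_group R.m_assoc)
    qed
    fix a m assume a: "a \<in> carrier (group_ring R H)" and m: "m \<in> carrier RG"
    have aR: "a h \<in> carrier R" if "h \<in> carrier H" for h using a that by (simp add: group_ring_def)
    have am: "(\<lambda>h. gr_single R h (a h) \<odot>\<^bsub>RG\<^esub> m) \<in> carrier H \<rightarrow> carrier RG"
      using aR act_closed m by auto
    show "a \<odot>\<^bsub>RG\<^esub> m = (\<Oplus>\<^bsub>RG\<^esub>h\<in>carrier H. gr_single R h (a h) \<odot>\<^bsub>RG\<^esub> m)"
    proof
      fix x
      show "(a \<odot>\<^bsub>RG\<^esub> m) x = (\<Oplus>\<^bsub>RG\<^esub>h\<in>carrier H. gr_single R h (a h) \<odot>\<^bsub>RG\<^esub> m) x"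
      proof (cases "x \<in> carrier G")
        case True
        then show ?thesis
          using aR RG_closed[OF m] m
          by (auto simp: abelian_group_hom.hom_finsum[OF RG_eval_hom[OF True] am] RG_smult RG_act
              intro!: R.finsum_cong')
      next
        case False
        then show ?thesis using RG.finsum_closed[OF am] by (simp add: RG_smult_outside carrier_RG)
      qed
    qed
  qed (auto simp: finite_H RG_act RG_closed carrier_RG fun_eq_iff R.l_distr R.r_distr action_one action_closed)
qed

end

subsection \<open>Complexes of homomorphisms, restriction and corestriction\<close>

lemma hom_module_simps [simp]:
  "\<zero>\<^bsub>hom_module R K M N\<^esub> = (\<lambda>p\<in>carrier M. \<zero>\<^bsub>N\<^esub>)"
  "f \<oplus>\<^bsub>hom_module R K M N\<^esub> f' = (\<lambda>p\<in>carrier M. f p \<oplus>\<^bsub>N\<^esub> f' p)"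
  "r \<odot>\<^bsub>hom_module R K M N\<^esub> f = (\<lambda>p\<in>carrier M. gr_single R \<one>\<^bsub>K\<^esub> r \<odot>\<^bsub>N\<^esub> f p)"
  by (simp_all add: hom_module_def)

lemma carrier_hom_module:
  "carrier (hom_module R K M N) = lmod_hom (group_ring R K) M N \<inter> extensional (carrier M)"
  by (simp add: hom_module_def)

lemma hom_moduleI:
  assumes M: "group_rep R H M" and N: "group_rep R H N" and L: "L \<subseteq> carrier H"
    and ext: "f \<in> extensional (carrier M)"
    and closed: "\<And>x. x \<in> carrier M \<Longrightarrow> f x \<in> carrier N"
    and add: "\<And>x y. \<lbrakk>x \<in> carrier M; y \<in> carrier M\<rbrakk> \<Longrightarrow> f (x \<oplus>\<^bsub>M\<^esub> y) = f x \<oplus>\<^bsub>N\<^esub> f y"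
    and act: "\<And>h r x. \<lbrakk>h \<in> L; r \<in> carrier R; x \<in> carrier M\<rbrakk> \<Longrightarrow>
      f (gr_single R h r \<odot>\<^bsub>M\<^esub> x) = gr_single R h r \<odot>\<^bsub>N\<^esub> f x"
  shows "f \<in> carrier (hom_module R (H\<lparr>carrier := L\<rparr>) M N)"
  using lmod_hom_group_ringI[OF M N L closed add act] ext by (simp add: carrier_hom_module)

lemma hom_moduleD:
  assumes "cring R" "f \<in> carrier (hom_module R (H\<lparr>carrier := L\<rparr>) M N)"
  shows "f \<in> extensional (carrier M)"
    and "\<And>x. x \<in> carrier M \<Longrightarrow> f x \<in> carrier N"
    and "\<And>x y. \<lbrakk>x \<in> carrier M; y \<in> carrier M\<rbrakk> \<Longrightarrow> f (x \<oplus>\<^bsub>M\<^esub> y) = f x \<oplus>\<^bsub>N\<^esub> f y"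
    and "\<And>h r x. \<lbrakk>h \<in> L; r \<in> carrier R; x \<in> carrier M\<rbrakk> \<Longrightarrow>
      f (gr_single R h r \<odot>\<^bsub>M\<^esub> x) = gr_single R h r \<odot>\<^bsub>N\<^esub> f x"
  using assms lmod_homD[of f "group_ring R (H\<lparr>carrier := L\<rparr>)" M N]
    lmod_hom_group_ring_act[OF assms(1), where f = f and H = H and L = L and M = M and N = N]
  by (auto simp: carrier_hom_module)

lemma hom_module_is_module:
  assumes M: "group_rep R H M" and N: "group_rep R H N" and L: "L \<subseteq> carrier H"
  shows "module R (hom_module R (H\<lparr>carrier := L\<rparr>) M N)"
proof -
  interpret M: group_rep R H M by fact
  interpret N: group_rep R H N by fact
  let ?C = "hom_module R (H\<lparr>carrier := L\<rparr>) M N"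
  note D = hom_moduleD[OF M.R.is_cring, where H = H and L = L and M = M and N = N]
  note I = hom_moduleI[OF M N L]
  have LH: "h \<in> carrier H" if "h \<in> L" for h using L that by auto
  have add: "f \<oplus>\<^bsub>?C\<^esub> f' \<in> carrier ?C" if f: "f \<in> carrier ?C" "f' \<in> carrier ?C" for f f'
  proof (rule I)
    fix x y assume "x \<in> carrier M" "y \<in> carrier M"
    then show "(f \<oplus>\<^bsub>?C\<^esub> f') (x \<oplus>\<^bsub>M\<^esub> y) = (f \<oplus>\<^bsub>?C\<^esub> f') x \<oplus>\<^bsub>N\<^esub> (f \<oplus>\<^bsub>?C\<^esub> f') y"
      by (simp add: D[OF f(1)] D[OF f(2)] N.N.a_ac)
  qed (auto simp: D[OF f(1)] D[OF f(2)] N.act_add LH)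
  have smult: "r \<odot>\<^bsub>?C\<^esub> f \<in> carrier ?C" if "r \<in> carrier R" "f \<in> carrier ?C" for r f
    by (rule I) (use that in \<open>auto simp: D[OF that(2)] N.act_add N.scalar_commute LH\<close>)
  have zero: "\<zero>\<^bsub>?C\<^esub> \<in> carrier ?C" by (rule I) (auto simp: LH)
  show ?thesis
  proof (rule moduleI)
    show "abelian_group ?C"
    proof (rule abelian_groupI)
      fix f assume f: "f \<in> carrier ?C"
      \<comment> \<open>The additive inverse of f is taken to be (-1) f, so that its membership is
        an instance of \<open>smult\<close>.\<close>
      have "gr_single R \<one>\<^bsub>H\<^esub> (\<ominus>\<^bsub>R\<^esub> \<one>\<^bsub>R\<^esub>) \<odot>\<^bsub>N\<^esub> f x \<oplus>\<^bsub>N\<^esub> f x = \<zero>\<^bsub>N\<^esub>" if "x \<in> carrier M" for x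
        using N.act_radd[of "\<one>\<^bsub>H\<^esub>" "\<ominus>\<^bsub>R\<^esub> \<one>\<^bsub>R\<^esub>" "\<one>\<^bsub>R\<^esub>" "f x"] D(2)[OF f that]
        by (simp add: M.R.l_neg N.act_one)
      then show "\<exists>f'\<in>carrier ?C. f' \<oplus>\<^bsub>?C\<^esub> f = \<zero>\<^bsub>?C\<^esub>"
        using smult[OF _ f, of "\<ominus>\<^bsub>R\<^esub> \<one>\<^bsub>R\<^esub>"] by (intro bexI[of _ "(\<ominus>\<^bsub>R\<^esub> \<one>\<^bsub>R\<^esub>) \<odot>\<^bsub>?C\<^esub> f"]) auto
      show "\<zero>\<^bsub>?C\<^esub> \<oplus>\<^bsub>?C\<^esub> f = f"
        using D(1,2)[OF f] by (auto intro!: extensionalityI[of _ "carrier M"])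
      fix f' assume f': "f' \<in> carrier ?C"
      show "f \<oplus>\<^bsub>?C\<^esub> f' = f' \<oplus>\<^bsub>?C\<^esub> f"
        using D(2)[OF f] D(2)[OF f'] by (auto simp: N.N.a_comm)
      fix f'' assume f'': "f'' \<in> carrier ?C"
      show "f \<oplus>\<^bsub>?C\<^esub> f' \<oplus>\<^bsub>?C\<^esub> f'' = f \<oplus>\<^bsub>?C\<^esub> (f' \<oplus>\<^bsub>?C\<^esub> f'')"
        using D(2)[OF f] D(2)[OF f'] D(2)[OF f''] by (auto simp: N.N.a_assoc)
    qed (use add zero in auto)
    show "\<one>\<^bsub>R\<^esub> \<odot>\<^bsub>?C\<^esub> f = f" if "f \<in> carrier ?C" for f
      using D(1,2)[OF that] by (auto simp: N.act_one intro!: extensionalityI[of _ "carrier M"])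
    show "(r \<otimes>\<^bsub>R\<^esub> s) \<odot>\<^bsub>?C\<^esub> f = r \<odot>\<^bsub>?C\<^esub> (s \<odot>\<^bsub>?C\<^esub> f)"
      if "r \<in> carrier R" "s \<in> carrier R" "f \<in> carrier ?C" for r s f
      using that(1,2) D(2)[OF that(3)] by (auto simp: N.act_mult)
    show "(r \<oplus>\<^bsub>R\<^esub> s) \<odot>\<^bsub>?C\<^esub> f = r \<odot>\<^bsub>?C\<^esub> f \<oplus>\<^bsub>?C\<^esub> s \<odot>\<^bsub>?C\<^esub> f"
      if "r \<in> carrier R" "s \<in> carrier R" "f \<in> carrier ?C" for r s f
      using that(1,2) D(2)[OF that(3)] by (auto simp: N.act_radd)
    show "r \<odot>\<^bsub>?C\<^esub> (f \<oplus>\<^bsub>?C\<^esub> f') = r \<odot>\<^bsub>?C\<^esub> f \<oplus>\<^bsub>?C\<^esub> r \<odot>\<^bsub>?C\<^esub> f'"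
      if "r \<in> carrier R" "f \<in> carrier ?C" "f' \<in> carrier ?C" for r f f'
      using that(1) D(2)[OF that(2)] D(2)[OF that(3)] by (auto simp: N.act_add)
  qed (use smult M.R.is_cring in auto)
qed

text \<open>This identification and the next one bring the Tate groups and their maps under the
  abstract theory. The coboundaries of degree n use \<open>d n\<close>, which is the index n - 1 + 1
  of the abstract differential.\<close>

lemma tate_degree_eq_cohomology:
  "tate_degree R K P d M = cohomology (\<lambda>n. hom_module R K (P n) M)
    (\<lambda>n f. compose (carrier (P (n + 1))) f (d (n + 1)))"
  by (simp add: fun_eq_iff tate_degree_def cohomology_def cocycles_def cocycle_set_def
      coboundaries_def coboundary_set_def)

lemma tate_map_eq_cohomology_map:
  "tate_map R K P d M F \<zeta> n = cohomology_map (\<lambda>n. hom_module R K (P n) M)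
    (\<lambda>n f. compose (carrier (P (n + 1))) f (d (n + 1))) F n (\<zeta> n)"
  by (simp add: tate_map_def cohomology_map_def coboundaries_def coboundary_set_def)

section \<open>Cochains on a complex of RH-modules\<close>

locale rep_complex =
  fixes R :: "('r, 'e) ring_scheme" and H :: "('h, 'k) monoid_scheme"
    and P :: "int \<Rightarrow> ('h \<Rightarrow> 'r, 'p) module" and d :: "int \<Rightarrow> 'p \<Rightarrow> 'p"
  assumes P_rep: "group_rep R H (P n)"
    and d_hom: "d n \<in> lmod_hom (group_ring R H) (P n) (P (n - 1))"
    and d_d: "x \<in> carrier (P n) \<Longrightarrow> d (n - 1) (d n x) = \<zero>\<^bsub>P (n - 1 - 1)\<^esub>"
begin

sublocale R: cring R using P_rep group_rep_def by blast
sublocale H: group H using P_rep group_rep_def by blast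

text \<open>Only the carrier of the group changes, while P stays the same for all subgroups. The
  full group is also written with the update \<open>L = carrier H\<close>, so that all cochain
  complexes have one shape.\<close>

abbreviation HomC :: "'h set \<Rightarrow> ('h \<Rightarrow> 'r, 'n) module \<Rightarrow> int \<Rightarrow> ('r, 'p \<Rightarrow> 'n) module"
  where "HomC L N \<equiv> \<lambda>n. hom_module R (H\<lparr>carrier := L\<rparr>) (P n) N"

text \<open>This is precomposition with d, without signs. It is made undefined outside the carrier
  because cochains are extensional functions.\<close>

abbreviation coboundary :: "int \<Rightarrow> ('p \<Rightarrow> 'n) \<Rightarrow> ('p \<Rightarrow> 'n)"
  where "coboundary \<equiv> \<lambda>n f. compose (carrier (P (n + 1))) f (d (n + 1))"

lemma HomC_D:
  assumes "f \<in> carrier (HomC L N n)"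
  shows "f \<in> extensional (carrier (P n))"
    and "\<And>x. x \<in> carrier (P n) \<Longrightarrow> f x \<in> carrier N"
    and "\<And>x y. \<lbrakk>x \<in> carrier (P n); y \<in> carrier (P n)\<rbrakk> \<Longrightarrow> f (x \<oplus>\<^bsub>P n\<^esub> y) = f x \<oplus>\<^bsub>N\<^esub> f y"
    and "\<And>h r x. \<lbrakk>h \<in> L; r \<in> carrier R; x \<in> carrier (P n)\<rbrakk> \<Longrightarrow>
      f (gr_single R h r \<odot>\<^bsub>P n\<^esub> x) = gr_single R h r \<odot>\<^bsub>N\<^esub> f x"
  by (fact hom_moduleD[OF R.is_cring assms])+

lemma HomC_zero:
  assumes "f \<in> carrier (HomC L N n)" "abelian_group N"
  shows "f \<zero>\<^bsub>P n\<^esub> = \<zero>\<^bsub>N\<^esub>"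
proof -
  interpret P: group_rep R H "P n" by (rule P_rep)
  interpret abelian_group_hom "P n" N f
    by (intro abelian_group_hom_additiveI P.N.abelian_group_axioms assms(2) HomC_D(2,3)[OF assms(1)])
  show ?thesis by simp
qed

lemma d_closed: "x \<in> carrier (P (n + 1)) \<Longrightarrow> d (n + 1) x \<in> carrier (P n)"
  using lmod_homD(1)[OF d_hom[of "n + 1"]] by simp

lemma d_add: "\<lbrakk>x \<in> carrier (P (n + 1)); y \<in> carrier (P (n + 1))\<rbrakk> \<Longrightarrow>
    d (n + 1) (x \<oplus>\<^bsub>P (n + 1)\<^esub> y) = d (n + 1) x \<oplus>\<^bsub>P n\<^esub> d (n + 1) y"
  using lmod_homD(2)[OF d_hom[of "n + 1"]] by simp

lemma d_act: "\<lbrakk>h \<in> carrier H; r \<in> carrier R; x \<in> carrier (P (n + 1))\<rbrakk> \<Longrightarrow>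
    d (n + 1) (gr_single R h r \<odot>\<^bsub>P (n + 1)\<^esub> x) = gr_single R h r \<odot>\<^bsub>P n\<^esub> d (n + 1) x"
  using lmod_homD(3)[OF d_hom[of "n + 1"]] gr_single_carrier[OF R.is_cring, of h H r] by simp

lemma HomC_complex:
  assumes N: "group_rep R H N" and L: "subgroup L H"
  shows "cochain_complex R (HomC L N) coboundary"
proof (rule cochain_complex.intro)
  interpret N: group_rep R H N by fact
  note LH = subgroup.subset[OF L]
  show "module R (HomC L N n)" for n by (rule hom_module_is_module[OF P_rep N LH])
  show "coboundary n \<in> lmod_hom R (HomC L N n) (HomC L N (n + 1))" for n
  proof (rule lmod_homI)
    interpret P: group_rep R H "P (n + 1)" by (rule P_rep)
    have LH': "h \<in> carrier H" if "h \<in> L" for h using LH that by auto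
    fix f assume f: "f \<in> carrier (HomC L N n)"
    show "coboundary n f \<in> carrier (HomC L N (n + 1))"
      by (rule hom_moduleI[OF P_rep N LH])
        (simp_all add: compose_eq HomC_D[OF f] d_closed d_add d_act LH')
    show "coboundary n (r \<odot>\<^bsub>HomC L N n\<^esub> f) = r \<odot>\<^bsub>HomC L N (n + 1)\<^esub> coboundary n f"
      if "r \<in> carrier R" for r
      by (auto simp: compose_def d_closed)
    show "coboundary n (f \<oplus>\<^bsub>HomC L N n\<^esub> f') = coboundary n f \<oplus>\<^bsub>HomC L N (n + 1)\<^esub> coboundary n f'" for f'
      by (auto simp: compose_def d_closed)
  qed
  show "coboundary (n + 1) (coboundary n f) = \<zero>\<^bsub>HomC L N (n + 1 + 1)\<^esub>" if f: "f \<in> carrier (HomC L N n)" for n f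
  proof (rule extensionalityI)
    fix x assume x: "x \<in> carrier (P (n + 1 + 1))"
    \<comment> \<open>The restricted simplification leaves the index in the form n + 1 + 1, in which
      the goal and \<open>d_closed\<close> state it.\<close>
    have "d (n + 1) (d (n + 1 + 1) x) = \<zero>\<^bsub>P n\<^esub>"
      using d_d[OF x] by (simp only: add_diff_cancel_right')
    then show "coboundary (n + 1) (coboundary n f) x = \<zero>\<^bsub>HomC L N (n + 1 + 1)\<^esub> x"
      using x d_closed[OF x] HomC_zero[OF f N.N.abelian_group_axioms]
      by (simp only: compose_eq hom_module_simps restrict_apply if_True)
  qed (simp_all only: hom_module_simps compose_extensional restrict_extensional)
qed

text \<open>Composition with \<eta> on the left commutes with precomposition by d. Linearity over RL
  is the right generality: \<theta> and \<pi> at x are linear over the stabilizer of x, in general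
  not over RH.\<close>

lemma coefficient_cochain_map:
  assumes N: "group_rep R H N" and N': "group_rep R H N'" and L: "subgroup L H"
    and \<eta>: "\<eta> \<in> lmod_hom (group_ring R (H\<lparr>carrier := L\<rparr>)) N N'"
  shows "cochain_map R (HomC L N) coboundary (HomC L N') coboundary (\<lambda>n f. compose (carrier (P n)) \<eta> f)"
proof -
  interpret C: cochain_complex R "HomC L N" coboundary by (rule HomC_complex[OF N L])
  interpret C': cochain_complex R "HomC L N'" coboundary by (rule HomC_complex[OF N' L])
  note act = lmod_hom_group_ring_act[OF R.is_cring \<eta>]
  note LH = subgroup.subset[OF L]
  show ?thesis
  proof unfold_locales
    fix n
    interpret P: group_rep R H "P n" by (rule P_rep)
    show "(\<lambda>f. compose (carrier (P n)) \<eta> f) \<in> lmod_hom R (HomC L N n) (HomC L N' n)"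
    proof (rule lmod_homI)
      have LH': "h \<in> carrier H" if "h \<in> L" for h using LH that by auto
      fix f assume f: "f \<in> carrier (HomC L N n)"
      show "compose (carrier (P n)) \<eta> f \<in> carrier (HomC L N' n)"
        by (rule hom_moduleI[OF P_rep N' LH])
          (simp_all add: compose_eq HomC_D[OF f] lmod_homD(1,2)[OF \<eta>] act LH')
      show "compose (carrier (P n)) \<eta> (r \<odot>\<^bsub>HomC L N n\<^esub> f) = r \<odot>\<^bsub>HomC L N' n\<^esub> compose (carrier (P n)) \<eta> f"
        if "r \<in> carrier R" for r
        using that HomC_D(2)[OF f] by (auto simp: compose_def act subgroup.one_closed[OF L])
      show "compose (carrier (P n)) \<eta> (f \<oplus>\<^bsub>HomC L N n\<^esub> f') =
          compose (carrier (P n)) \<eta> f \<oplus>\<^bsub>HomC L N' n\<^esub> compose (carrier (P n)) \<eta> f'"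
        if f': "f' \<in> carrier (HomC L N n)" for f'
        using HomC_D(2)[OF f] HomC_D(2)[OF f'] by (auto simp: compose_def lmod_homD(2)[OF \<eta>])
    qed
  next
    show "compose (carrier (P (n + 1))) \<eta> (coboundary n f) = coboundary n (compose (carrier (P n)) \<eta> f)" for n f
      by (auto simp: compose_def d_closed)
  qed
qed

text \<open>Linearity over RH includes linearity over RL, and both differentials are the same
  formula, so the inclusion of cochains is the identity function.\<close>

lemma restriction_cochain_map:
  assumes N: "group_rep R H N" and L: "subgroup L H"
  shows "cochain_map R (HomC (carrier H) N) coboundary (HomC L N) coboundary (\<lambda>n f. f)"
proof -
  interpret C: cochain_complex R "HomC (carrier H) N" coboundary
    by (rule HomC_complex[OF N H.subgroup_self])
  interpret C': cochain_complex R "HomC L N" coboundary by (rule HomC_complex[OF N L])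
  note LH = subgroup.subset[OF L]
  show ?thesis
  proof unfold_locales
    show "(\<lambda>f. f) \<in> lmod_hom R (HomC (carrier H) N n) (HomC L N n)" for n
    proof (rule lmod_homI)
      fix f assume f: "f \<in> carrier (HomC (carrier H) N n)"
      show "f \<in> carrier (HomC L N n)"
        using LH by (intro hom_moduleI[OF P_rep N LH]) (auto simp: HomC_D[OF f])
    qed simp_all
  qed simp
qed

text \<open>This is the cochain formula inside \<open>tate_cor\<close> with K = H, written so that
  the two agree by unfolding.\<close>

definition corestriction :: "'h set \<Rightarrow> ('h \<Rightarrow> 'r, 'n) module \<Rightarrow> int \<Rightarrow> ('p \<Rightarrow> 'n) \<Rightarrow> 'p \<Rightarrow> 'n"
  where "corestriction U N n f = (\<lambda>p\<in>carrier (P n). \<Oplus>\<^bsub>N\<^esub>u\<in>U.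
    gr_single R u \<one>\<^bsub>R\<^esub> \<odot>\<^bsub>N\<^esub> f (gr_single R (inv\<^bsub>H\<^esub> u) \<one>\<^bsub>R\<^esub> \<odot>\<^bsub>P n\<^esub> p))"

text \<open>The summand u f(u^-1 p) depends only on the coset u L, and k sends the summand of u at p
  to that of k u at k p. So k permutes the summands, which gives linearity over RH. Compatibility
  with the differentials comes from equivariance of d.\<close>

lemma corestriction_cochain_map:
  assumes N: "group_rep R H N" and L: "subgroup L H" and U: "left_coset_reps H L U"
  shows "cochain_map R (HomC L N) coboundary (HomC (carrier H) N) coboundary (corestriction U N)"
proof -
  interpret C: cochain_complex R "HomC L N" coboundary by (rule HomC_complex[OF N L])
  interpret C': cochain_complex R "HomC (carrier H) N" coboundary
    by (rule HomC_complex[OF N H.subgroup_self])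
  interpret N: group_rep R H N by fact
  interpret L: subgroup L H by fact
  have UH: "U \<subseteq> carrier H" and Uex: "\<And>x. x \<in> carrier H \<Longrightarrow> \<exists>!u. u \<in> U \<and> x \<in> u <#\<^bsub>H\<^esub> L"
    using U by (auto simp: left_coset_reps_def)
  have finU: "finite U" using UH N.finite_group finite_subset by blast
  have uH: "u \<in> carrier H" if "u \<in> U" for u using UH that by auto
  \<comment> \<open>The element of \<open>U\<close> that represents the left coset of x.\<close>
  define \<rho> where "\<rho> x = (THE u. u \<in> U \<and> x \<in> u <#\<^bsub>H\<^esub> L)" for x
  have \<rho>: "\<rho> x \<in> U" "x \<in> \<rho> x <#\<^bsub>H\<^esub> L" if "x \<in> carrier H" for x
    using theI'[OF Uex[OF that]] by (auto simp: \<rho>_def)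
  have coset_refl: "x \<in> x <#\<^bsub>H\<^esub> L" if "x \<in> carrier H" for x
    using that L.one_closed by (force simp: l_coset_def)
  \<comment> \<open>Left translation by k permutes the left cosets and hence their representatives.
    Injectivity is enough because \<open>U\<close> is finite.\<close>
  have perm: "inj_on (\<lambda>u. \<rho> (k \<otimes>\<^bsub>H\<^esub> u)) U \<and> (\<lambda>u. \<rho> (k \<otimes>\<^bsub>H\<^esub> u)) ` U = U" if k: "k \<in> carrier H" for k
  proof -
    have "inj_on (\<lambda>u. \<rho> (k \<otimes>\<^bsub>H\<^esub> u)) U"
    proof (rule inj_onI)
      fix u v assume uv: "u \<in> U" "v \<in> U" "\<rho> (k \<otimes>\<^bsub>H\<^esub> u) = \<rho> (k \<otimes>\<^bsub>H\<^esub> v)"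
      define w where "w = \<rho> (k \<otimes>\<^bsub>H\<^esub> u)"
      have w: "w \<in> carrier H" using \<rho>(1)[of "k \<otimes>\<^bsub>H\<^esub> u"] uv k uH by (auto simp: w_def)
      obtain l where l: "l \<in> L" "k \<otimes>\<^bsub>H\<^esub> u = w \<otimes>\<^bsub>H\<^esub> l"
        using \<rho>(2)[of "k \<otimes>\<^bsub>H\<^esub> u"] uv k uH by (auto simp: l_coset_def w_def)
      obtain m where m: "m \<in> L" "k \<otimes>\<^bsub>H\<^esub> v = w \<otimes>\<^bsub>H\<^esub> m"
        using \<rho>(2)[of "k \<otimes>\<^bsub>H\<^esub> v"] uv k uH by (auto simp: l_coset_def w_def)
      have "u = inv\<^bsub>H\<^esub> k \<otimes>\<^bsub>H\<^esub> (w \<otimes>\<^bsub>H\<^esub> l)" "v = inv\<^bsub>H\<^esub> k \<otimes>\<^bsub>H\<^esub> (w \<otimes>\<^bsub>H\<^esub> m)"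
        using l(2)[symmetric] m(2)[symmetric] k uv uH by (simp_all add: H.m_assoc[symmetric])
      \<comment> \<open>If k u and k v lie in one coset, then so do u and v, since v^-1 u = m^-1 l
        lies in L; uniqueness of representatives finishes.\<close>
      then have "u = v \<otimes>\<^bsub>H\<^esub> (inv\<^bsub>H\<^esub> m \<otimes>\<^bsub>H\<^esub> l)"
        using k w l(1) m(1) by (simp add: H.m_assoc H.inv_solve_left)
          (simp add: H.m_assoc[symmetric])
      then have "u \<in> v <#\<^bsub>H\<^esub> L" using l(1) m(1) by (auto simp: l_coset_def)
      then show "u = v" using Uex[OF uH[OF uv(1)]] coset_refl[OF uH[OF uv(1)]] uv(1,2) by blast
    qed
    moreover have "(\<lambda>u. \<rho> (k \<otimes>\<^bsub>H\<^esub> u)) ` U \<subseteq> U" using \<rho>(1) k uH by auto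
    ultimately show ?thesis using endo_inj_surj[OF finU] by blast
  qed
  let ?T = "\<lambda>n f p u. gr_single R u \<one>\<^bsub>R\<^esub> \<odot>\<^bsub>N\<^esub> f (gr_single R (inv\<^bsub>H\<^esub> u) \<one>\<^bsub>R\<^esub> \<odot>\<^bsub>P n\<^esub> p)"
  have T_closed: "?T n f p u \<in> carrier N"
    if f: "f \<in> carrier (HomC L N n)" and "p \<in> carrier (P n)" "u \<in> carrier H" for n f p u
  proof -
    interpret P: group_rep R H "P n" by (rule P_rep)
    show ?thesis using that HomC_D(2)[OF f] by simp
  qed
  \<comment> \<open>By linearity over L the factor l cancels: (u l) f(l^-1 u^-1 p) = u f(u^-1
    p).\<close>
  have T_coset: "?T n f p (u \<otimes>\<^bsub>H\<^esub> l) = ?T n f p u"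
    if f: "f \<in> carrier (HomC L N n)" and p: "p \<in> carrier (P n)" and u: "u \<in> carrier H" and l: "l \<in> L" for n f p u l
  proof -
    interpret P: group_rep R H "P n" by (rule P_rep)
    let ?y = "gr_single R (inv\<^bsub>H\<^esub> u) \<one>\<^bsub>R\<^esub> \<odot>\<^bsub>P n\<^esub> p"
    have y: "?y \<in> carrier (P n)" using p u by simp
    have "?T n f p (u \<otimes>\<^bsub>H\<^esub> l) = gr_single R (u \<otimes>\<^bsub>H\<^esub> l) \<one>\<^bsub>R\<^esub> \<odot>\<^bsub>N\<^esub> f (gr_single R (inv\<^bsub>H\<^esub> l) \<one>\<^bsub>R\<^esub> \<odot>\<^bsub>P n\<^esub> ?y)"
      using p u l by (simp add: P.act_mult H.inv_mult_group)
    also have "\<dots> = gr_single R u \<one>\<^bsub>R\<^esub> \<odot>\<^bsub>N\<^esub> f ?y"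
      using y u l HomC_D(2,4)[OF f] by (simp add: N.act_mult H.m_assoc)
    finally show ?thesis .
  qed
  \<comment> \<open>Applying (k u)^-1 to the translate r k p gives r u^-1 p. The scalar r passes
    through f because the identity of H lies in L.\<close>
  have T_act: "gr_single R k r \<odot>\<^bsub>N\<^esub> ?T n f p u = ?T n f (gr_single R k r \<odot>\<^bsub>P n\<^esub> p) (k \<otimes>\<^bsub>H\<^esub> u)"
    if f: "f \<in> carrier (HomC L N n)" and p: "p \<in> carrier (P n)" and u: "u \<in> carrier H"
      and k: "k \<in> carrier H" and r: "r \<in> carrier R" for n f p u k r
  proof -
    interpret P: group_rep R H "P n" by (rule P_rep)
    let ?y = "gr_single R (inv\<^bsub>H\<^esub> u) \<one>\<^bsub>R\<^esub> \<odot>\<^bsub>P n\<^esub> p"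
    have y: "?y \<in> carrier (P n)" using p u by simp
    have "gr_single R (inv\<^bsub>H\<^esub> (k \<otimes>\<^bsub>H\<^esub> u)) \<one>\<^bsub>R\<^esub> \<odot>\<^bsub>P n\<^esub> (gr_single R k r \<odot>\<^bsub>P n\<^esub> p) =
        gr_single R \<one>\<^bsub>H\<^esub> r \<odot>\<^bsub>P n\<^esub> ?y"
      using p u k r by (simp add: P.act_mult H.inv_mult_group H.m_assoc)
    then show ?thesis
      using y u k r HomC_D(2,4)[OF f] by (simp add: N.act_mult L.one_closed)
  qed
  have cor_hom: "corestriction U N n f \<in> carrier (HomC (carrier H) N n)"
    if f: "f \<in> carrier (HomC L N n)" for n f
  proof -
    interpret P: group_rep R H "P n" by (rule P_rep)
    show ?thesis
    proof (rule hom_moduleI[OF P_rep N order_refl])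
      show "corestriction U N n f \<in> extensional (carrier (P n))" by (simp add: corestriction_def)
      fix x assume x: "x \<in> carrier (P n)"
      show "corestriction U N n f x \<in> carrier N"
        using x T_closed[OF f x] uH by (auto simp: corestriction_def intro!: N.N.finsum_closed)
      show "corestriction U N n f (x \<oplus>\<^bsub>P n\<^esub> y) = corestriction U N n f x \<oplus>\<^bsub>N\<^esub> corestriction U N n f y"
        if y: "y \<in> carrier (P n)" for y
      proof -
        have "?T n f (x \<oplus>\<^bsub>P n\<^esub> y) u = ?T n f x u \<oplus>\<^bsub>N\<^esub> ?T n f y u" if "u \<in> U" for u
          using uH[OF that] x y by (simp add: P.act_add N.act_add HomC_D[OF f])
        then have "(\<Oplus>\<^bsub>N\<^esub>u\<in>U. ?T n f (x \<oplus>\<^bsub>P n\<^esub> y) u) = (\<Oplus>\<^bsub>N\<^esub>u\<in>U. ?T n f x u \<oplus>\<^bsub>N\<^esub> ?T n f y u)"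
          using T_closed[OF f x] T_closed[OF f y] uH by (intro N.N.finsum_cong') auto
        also have "\<dots> = (\<Oplus>\<^bsub>N\<^esub>u\<in>U. ?T n f x u) \<oplus>\<^bsub>N\<^esub> (\<Oplus>\<^bsub>N\<^esub>u\<in>U. ?T n f y u)"
          using T_closed[OF f x] T_closed[OF f y] uH by (intro N.N.finsum_addf) auto
        finally show ?thesis using x y by (simp add: corestriction_def)
      qed
      show "corestriction U N n f (gr_single R k r \<odot>\<^bsub>P n\<^esub> x) = gr_single R k r \<odot>\<^bsub>N\<^esub> corestriction U N n f x"
        if k: "k \<in> carrier H" and r: "r \<in> carrier R" for k r
      proof -
        let ?x = "gr_single R k r \<odot>\<^bsub>P n\<^esub> x"
        have x': "?x \<in> carrier (P n)" using x k r by simp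
        interpret a: abelian_group_hom N N "\<lambda>y. gr_single R k r \<odot>\<^bsub>N\<^esub> y" by (rule N.act_hom[OF k r])
        have "gr_single R k r \<odot>\<^bsub>N\<^esub> (\<Oplus>\<^bsub>N\<^esub>u\<in>U. ?T n f x u) = (\<Oplus>\<^bsub>N\<^esub>u\<in>U. gr_single R k r \<odot>\<^bsub>N\<^esub> ?T n f x u)"
          using T_closed[OF f x] uH by (intro a.hom_finsum) auto
        also have "\<dots> = (\<Oplus>\<^bsub>N\<^esub>u\<in>U. ?T n f ?x (\<rho> (k \<otimes>\<^bsub>H\<^esub> u)))"
        proof (rule N.N.finsum_cong')
          fix u assume u: "u \<in> U"
          have ku: "k \<otimes>\<^bsub>H\<^esub> u \<in> carrier H" using k uH[OF u] by simp
          obtain l where l: "l \<in> L" "k \<otimes>\<^bsub>H\<^esub> u = \<rho> (k \<otimes>\<^bsub>H\<^esub> u) \<otimes>\<^bsub>H\<^esub> l"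
            using \<rho>(2)[OF ku] by (auto simp: l_coset_def)
          have "gr_single R k r \<odot>\<^bsub>N\<^esub> ?T n f x u = ?T n f ?x (k \<otimes>\<^bsub>H\<^esub> u)"
            by (rule T_act[OF f x uH[OF u] k r])
          also have "\<dots> = ?T n f ?x (\<rho> (k \<otimes>\<^bsub>H\<^esub> u) \<otimes>\<^bsub>H\<^esub> l)" using l(2) by simp
          also have "\<dots> = ?T n f ?x (\<rho> (k \<otimes>\<^bsub>H\<^esub> u))"
            by (rule T_coset[OF f x' uH[OF \<rho>(1)[OF ku]] l(1)])
          finally show "gr_single R k r \<odot>\<^bsub>N\<^esub> ?T n f x u = ?T n f ?x (\<rho> (k \<otimes>\<^bsub>H\<^esub> u))" .
        qed (use T_closed[OF f x'] uH \<rho>(1) k in auto)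
        \<comment> \<open>Reindexing along the permutation of \<open>U\<close> from
          \<open>perm\<close>.\<close>
        also have "\<dots> = (\<Oplus>\<^bsub>N\<^esub>u\<in>U. ?T n f ?x u)"
          using N.N.finsum_reindex[of "?T n f ?x" "\<lambda>u. \<rho> (k \<otimes>\<^bsub>H\<^esub> u)" U] perm[OF k] T_closed[OF f x'] uH
          by auto
        finally show ?thesis using x x' by (simp add: corestriction_def)
      qed
    qed
  qed
  show ?thesis
  proof unfold_locales
    fix n
    interpret P: group_rep R H "P n" by (rule P_rep)
    show "corestriction U N n \<in> lmod_hom R (HomC L N n) (HomC (carrier H) N n)"
    proof (rule lmod_homI[OF cor_hom])
      fix f assume f: "f \<in> carrier (HomC L N n)"
      show "corestriction U N n (f \<oplus>\<^bsub>HomC L N n\<^esub> f') =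
          corestriction U N n f \<oplus>\<^bsub>HomC (carrier H) N n\<^esub> corestriction U N n f'"
        if f': "f' \<in> carrier (HomC L N n)" for f'
      proof (rule extensionalityI[of _ "carrier (P n)"])
        fix p assume p: "p \<in> carrier (P n)"
        have "?T n (f \<oplus>\<^bsub>HomC L N n\<^esub> f') p u = ?T n f p u \<oplus>\<^bsub>N\<^esub> ?T n f' p u" if "u \<in> U" for u
          using uH[OF that] p by (simp add: N.act_add HomC_D(2)[OF f] HomC_D(2)[OF f'])
        then have "(\<Oplus>\<^bsub>N\<^esub>u\<in>U. ?T n (f \<oplus>\<^bsub>HomC L N n\<^esub> f') p u) = (\<Oplus>\<^bsub>N\<^esub>u\<in>U. ?T n f p u \<oplus>\<^bsub>N\<^esub> ?T n f' p u)"
          using T_closed[OF f p] T_closed[OF f' p] uH by (intro N.N.finsum_cong') auto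
        also have "\<dots> = (\<Oplus>\<^bsub>N\<^esub>u\<in>U. ?T n f p u) \<oplus>\<^bsub>N\<^esub> (\<Oplus>\<^bsub>N\<^esub>u\<in>U. ?T n f' p u)"
          using T_closed[OF f p] T_closed[OF f' p] uH by (intro N.N.finsum_addf) auto
        finally show "corestriction U N n (f \<oplus>\<^bsub>HomC L N n\<^esub> f') p =
            (corestriction U N n f \<oplus>\<^bsub>HomC (carrier H) N n\<^esub> corestriction U N n f') p"
          using p unfolding corestriction_def by simp
      qed (simp_all add: corestriction_def)
      show "corestriction U N n (r \<odot>\<^bsub>HomC L N n\<^esub> f) = r \<odot>\<^bsub>HomC (carrier H) N n\<^esub> corestriction U N n f"
        if r: "r \<in> carrier R" for r
      proof (rule extensionalityI[of _ "carrier (P n)"])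
        fix p assume p: "p \<in> carrier (P n)"
        interpret a: abelian_group_hom N N "\<lambda>y. gr_single R \<one>\<^bsub>H\<^esub> r \<odot>\<^bsub>N\<^esub> y"
          by (rule N.act_hom[OF H.one_closed r])
        have "?T n (r \<odot>\<^bsub>HomC L N n\<^esub> f) p u = gr_single R \<one>\<^bsub>H\<^esub> r \<odot>\<^bsub>N\<^esub> ?T n f p u" if "u \<in> U" for u
          using uH[OF that] p r by (simp add: N.scalar_commute HomC_D(2)[OF f])
        then have "(\<Oplus>\<^bsub>N\<^esub>u\<in>U. ?T n (r \<odot>\<^bsub>HomC L N n\<^esub> f) p u) = (\<Oplus>\<^bsub>N\<^esub>u\<in>U. gr_single R \<one>\<^bsub>H\<^esub> r \<odot>\<^bsub>N\<^esub> ?T n f p u)"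
          using T_closed[OF f p] r uH by (intro N.N.finsum_cong') auto
        also have "\<dots> = gr_single R \<one>\<^bsub>H\<^esub> r \<odot>\<^bsub>N\<^esub> (\<Oplus>\<^bsub>N\<^esub>u\<in>U. ?T n f p u)"
          using T_closed[OF f p] uH by (intro a.hom_finsum[symmetric]) auto
        finally show "corestriction U N n (r \<odot>\<^bsub>HomC L N n\<^esub> f) p =
            (r \<odot>\<^bsub>HomC (carrier H) N n\<^esub> corestriction U N n f) p"
          using p unfolding corestriction_def by simp
      qed (simp_all add: corestriction_def)
    qed
  next
    fix n f assume f: "f \<in> carrier (HomC L N n)"
    interpret P: group_rep R H "P (n + 1)" by (rule P_rep)
    show "corestriction U N (n + 1) (coboundary n f) = coboundary n (corestriction U N n f)"
    proof (rule extensionalityI[of _ "carrier (P (n + 1))"])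
      fix p assume p: "p \<in> carrier (P (n + 1))"
      \<comment> \<open>The differential d commutes with the action of u^-1, so the two sums agree
        term by term.\<close>
      have "?T (n + 1) (coboundary n f) p u = ?T n f (d (n + 1) p) u" if "u \<in> U" for u
        using uH[OF that] p by (simp add: compose_eq d_act)
      then have "(\<Oplus>\<^bsub>N\<^esub>u\<in>U. ?T (n + 1) (coboundary n f) p u) = (\<Oplus>\<^bsub>N\<^esub>u\<in>U. ?T n f (d (n + 1) p) u)"
        using T_closed[OF f d_closed[OF p]] uH by (intro N.N.finsum_cong') auto
      then show "corestriction U N (n + 1) (coboundary n f) p = coboundary n (corestriction U N n f) p"
        using p d_closed[OF p] unfolding corestriction_def by (simp add: compose_eq)
    qed (simp_all add: corestriction_def)
  qed
qed

end

subsection \<open>The permutation module\<close>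

text \<open>Automorphisms of G are bijections of its carrier, and both groups have the same
  composition.\<close>

lemma group_action_of_automorphisms:
  assumes "group_hom H (AutoGroup G) \<phi>"
  shows "group_action H (carrier G) \<phi>"
proof -
  interpret group_hom H "AutoGroup G" \<phi> by fact
  have "\<phi> \<in> hom H (BijGroup (carrier G))"
    using homh by (auto simp: hom_def AutoGroup_def BijGroup_def auto_def Pi_def)
  then show ?thesis
    by (intro group_action.intro group_hom.intro group_hom_axioms.intro group_BijGroup G.group_axioms)
qed

text \<open>That d d = 0 is the inclusion of the image in the kernel, taken from exactness at P (n -
  1).\<close>

lemma rep_complex_complete_resolution:
  assumes "cring R" "group H" "finite (carrier H)" and P: "complete_resolution R H P d"
  shows "rep_complex R H P d"
proof (rule rep_complex.intro)
  have hom: "d n \<in> lmod_hom (group_ring R H) (P n) (P (n - 1))"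
    and ker: "a_kernel (P n) (P (n - 1)) (d n) = d (n + 1) ` carrier (P (n + 1))"
    and P: "left_module (group_ring R H) (P n)" for n
    using P by (auto simp: complete_resolution_def)
  show "group_rep R H (P n)" "d n \<in> lmod_hom (group_ring R H) (P n) (P (n - 1))" for n
    using group_rep_left_module[OF assms(1-3) P] hom by auto
  show "d (n - 1) (d n x) = \<zero>\<^bsub>P (n - 1 - 1)\<^esub>" if "x \<in> carrier (P n)" for n x
  proof -
    have "d n x \<in> a_kernel (P (n - 1)) (P (n - 1 - 1)) (d (n - 1))"
      using that ker[of "n - 1"] by simp
    then show ?thesis by (simp add: a_kernel_def')
  qed
qed

section \<open>Coefficients of cochains with values in RG\<close>

locale permutation_complex = permutation_module R H G \<phi> + rep_complex R H P d
  for R :: "('r, 'e) ring_scheme" and H :: "('h, 'k) monoid_scheme"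
    and G :: "('g, 'l) monoid_scheme" and \<phi> :: "'h \<Rightarrow> 'g \<Rightarrow> 'g"
    and P :: "int \<Rightarrow> ('h \<Rightarrow> 'r, 'p) module" and d :: "int \<Rightarrow> 'p \<Rightarrow> 'p"
begin

abbreviation triv :: "('h \<Rightarrow> 'r, 'r) module" where "triv \<equiv> trivial_module R H"

lemma group_rep_triv: "group_rep R H triv"
  by (rule group_rep_trivial_module[OF R.is_cring H.group_axioms finite_H])

lemma stabilizer_subgroup: "x \<in> carrier G \<Longrightarrow> subgroup (stabilizer H \<phi> x) H"
  by (rule action.stabilizer_subgroup)

lemma stabilizerD: "h \<in> stabilizer H \<phi> x \<Longrightarrow> h \<in> carrier H \<and> \<phi> h x = x"
  by (simp add: stabilizer_def)

lemma action_inv_iff: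
  assumes "h \<in> carrier H" "x \<in> carrier G" "y \<in> carrier G"
  shows "\<phi> (inv\<^bsub>H\<^esub> h) y = x \<longleftrightarrow> y = \<phi> h x"
  using assms action_inv by auto

lemma gr_single_apply: "gr_single R x r y = (if y = x then r else \<zero>\<^bsub>R\<^esub>)"
  by (simp add: gr_single_def)

lemma gr_single_RG: "\<lbrakk>x \<in> carrier G; r \<in> carrier R\<rbrakk> \<Longrightarrow> gr_single R x r \<in> carrier RG"
  by (auto simp: carrier_RG gr_single_def)

text \<open>An element h of the stabilizer fixes x, so translating r x by h moves no coefficient
  away from x.\<close>

lemma gr_single_hom:
  assumes x: "x \<in> carrier G"
  shows "gr_single R x \<in> lmod_hom (group_ring R (H\<lparr>carrier := stabilizer H \<phi> x\<rparr>)) triv RG"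
proof (rule lmod_hom_group_ringI[OF group_rep_triv group_rep_RG])
  show "stabilizer H \<phi> x \<subseteq> carrier H" by (rule subgroup.subset[OF stabilizer_subgroup[OF x]])
  fix h r s assume h: "h \<in> stabilizer H \<phi> x" and r: "r \<in> carrier R" and s: "s \<in> carrier triv"
  have "\<phi> (inv\<^bsub>H\<^esub> h) y = x \<longleftrightarrow> y = x" if "y \<in> carrier G" for y
    using stabilizerD[OF h] action_inv_iff[OF _ x that] by simp
  then show "gr_single R x (gr_single R h r \<odot>\<^bsub>triv\<^esub> s) = gr_single R h r \<odot>\<^bsub>RG\<^esub> gr_single R x s"
    using stabilizerD[OF h] r s x
    by (auto simp: trivial_module_act[OF R.is_cring finite_H] RG_act gr_single_RG fun_eq_iff)
      (auto simp: gr_single_def)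
qed (use x in \<open>auto simp: gr_single_RG\<close>, auto simp: gr_single_def)

text \<open>The coefficient of h m at x is that of m at h^-1 x, which is x for h in the
  stabilizer.\<close>

lemma gr_coeff_hom:
  assumes x: "x \<in> carrier G"
  shows "gr_coeff x \<in> lmod_hom (group_ring R (H\<lparr>carrier := stabilizer H \<phi> x\<rparr>)) RG triv"
proof (rule lmod_hom_group_ringI[OF group_rep_RG group_rep_triv])
  show "stabilizer H \<phi> x \<subseteq> carrier H" by (rule subgroup.subset[OF stabilizer_subgroup[OF x]])
  fix h r m assume h: "h \<in> stabilizer H \<phi> x" and r: "r \<in> carrier R" and m: "m \<in> carrier RG"
  have "\<phi> (inv\<^bsub>H\<^esub> h) x = x"
    using stabilizerD[OF h] action_inv_iff[OF _ x x] by simp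
  then show "gr_coeff x (gr_single R h r \<odot>\<^bsub>RG\<^esub> m) = gr_single R h r \<odot>\<^bsub>triv\<^esub> gr_coeff x m"
    using stabilizerD[OF h] r m x RG_closed[OF m]
    by (simp add: trivial_module_act[OF R.is_cring finite_H] RG_act gr_coeff_def)
qed (use x RG_closed in \<open>auto simp: gr_coeff_def\<close>)

text \<open>The summand of u is a multiple of the single basis element u x, hence it contributes to
  the coefficient at y only if y = u x. Evaluation at y is additive and can be taken under the
  sum.\<close>

lemma corestriction_gr_single:
  assumes x: "x \<in> carrier G" and y: "y \<in> carrier G" and U: "U \<subseteq> carrier H"
    and b: "b \<in> carrier (HomC (stabilizer H \<phi> x) triv n)" and p: "p \<in> carrier (P n)"
  shows "corestriction U RG n (compose (carrier (P n)) (gr_single R x) b) p y =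
    (\<Oplus>\<^bsub>R\<^esub>u\<in>U. if y = \<phi> u x then b (gr_single R (inv\<^bsub>H\<^esub> u) \<one>\<^bsub>R\<^esub> \<odot>\<^bsub>P n\<^esub> p) else \<zero>\<^bsub>R\<^esub>)"
proof -
  interpret P: group_rep R H "P n" by (rule P_rep)
  interpret N: group_rep R H RG by (rule group_rep_RG)
  have uH: "u \<in> carrier H" if "u \<in> U" for u using U that by auto
  let ?q = "\<lambda>u. gr_single R (inv\<^bsub>H\<^esub> u) \<one>\<^bsub>R\<^esub> \<odot>\<^bsub>P n\<^esub> p"
  have q: "?q u \<in> carrier (P n)" if "u \<in> U" for u using uH[OF that] p by simp
  have bq: "b (?q u) \<in> carrier R" if "u \<in> U" for u using HomC_D(2)[OF b q[OF that]] by simp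
  have summand: "(gr_single R u \<one>\<^bsub>R\<^esub> \<odot>\<^bsub>RG\<^esub> gr_single R x (b (?q u))) y =
      (if y = \<phi> u x then b (?q u) else \<zero>\<^bsub>R\<^esub>)" if u: "u \<in> U" for u
    using action_inv_iff[OF uH[OF u] x y] uH[OF u] bq[OF u] y
    by (simp add: RG_act gr_single_RG[OF x] gr_single_apply)
  have closed: "(\<lambda>u. gr_single R u \<one>\<^bsub>R\<^esub> \<odot>\<^bsub>RG\<^esub> gr_single R x (b (?q u))) \<in> U \<rightarrow> carrier RG"
    using uH bq gr_single_RG[OF x] by auto
  have "corestriction U RG n (compose (carrier (P n)) (gr_single R x) b) p =
      (\<Oplus>\<^bsub>RG\<^esub>u\<in>U. gr_single R u \<one>\<^bsub>R\<^esub> \<odot>\<^bsub>RG\<^esub> gr_single R x (b (?q u)))"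
    unfolding corestriction_def restrict_apply if_P[OF p]
    by (rule N.N.finsum_cong'[OF refl closed]) (simp only: compose_eq[OF q])
  then have "corestriction U RG n (compose (carrier (P n)) (gr_single R x) b) p y =
      (\<Oplus>\<^bsub>R\<^esub>u\<in>U. (gr_single R u \<one>\<^bsub>R\<^esub> \<odot>\<^bsub>RG\<^esub> gr_single R x (b (?q u))) y)"
    using abelian_group_hom.hom_finsum[OF RG_eval_hom[OF y] closed] by simp
  also have "\<dots> = (\<Oplus>\<^bsub>R\<^esub>u\<in>U. if y = \<phi> u x then b (?q u) else \<zero>\<^bsub>R\<^esub>)"
    using bq by (intro R.finsum_cong') (auto simp: summand)
  finally show ?thesis .
qed

lemma corestriction_gr_single_other_orbit:
  assumes "x \<in> carrier G" "y \<in> carrier G" "U \<subseteq> carrier H"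
    and "b \<in> carrier (HomC (stabilizer H \<phi> x) triv n)" "p \<in> carrier (P n)"
    and y: "y \<notin> orbit H \<phi> x"
  shows "corestriction U RG n (compose (carrier (P n)) (gr_single R x) b) p y = \<zero>\<^bsub>R\<^esub>"
proof -
  have "y \<noteq> \<phi> u x" if "u \<in> U" for u using that assms(3) y by (auto simp: orbit_def)
  then have "(\<Oplus>\<^bsub>R\<^esub>u\<in>U. if y = \<phi> u x then b (gr_single R (inv\<^bsub>H\<^esub> u) \<one>\<^bsub>R\<^esub> \<odot>\<^bsub>P n\<^esub> p) else \<zero>\<^bsub>R\<^esub>) =
      (\<Oplus>\<^bsub>R\<^esub>u\<in>U. \<zero>\<^bsub>R\<^esub>)"
    by (intro R.finsum_cong') auto
  then show ?thesis using corestriction_gr_single[OF assms(1-5)] by simp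
qed

text \<open>Only the representative of the coset of the stabilizer itself contributes to the coefficient
  of \<open>x\<close>.\<close>

lemma corestriction_gr_single_same:
  assumes x: "x \<in> carrier G" and U: "left_coset_reps H (stabilizer H \<phi> x) U"
    and b: "b \<in> carrier (HomC (stabilizer H \<phi> x) triv n)" and p: "p \<in> carrier (P n)"
  shows "corestriction U RG n (compose (carrier (P n)) (gr_single R x) b) p x = b p"
proof -
  interpret P: group_rep R H "P n" by (rule P_rep)
  let ?L = "stabilizer H \<phi> x"
  interpret L: subgroup ?L H by (rule stabilizer_subgroup[OF x])
  have UH: "U \<subseteq> carrier H" and "\<exists>!u. u \<in> U \<and> \<one>\<^bsub>H\<^esub> \<in> u <#\<^bsub>H\<^esub> ?L"
    using U by (auto simp: left_coset_reps_def)
  then obtain u0 where u0: "u0 \<in> U" "\<one>\<^bsub>H\<^esub> \<in> u0 <#\<^bsub>H\<^esub> ?L"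
      and unique: "\<And>u. \<lbrakk>u \<in> U; \<one>\<^bsub>H\<^esub> \<in> u <#\<^bsub>H\<^esub> ?L\<rbrakk> \<Longrightarrow> u = u0"
    by blast
  have finU: "finite U" using UH finite_H finite_subset by blast
  \<comment> \<open>This locates the representative of the trivial coset: it is the unique element
    of \<open>U\<close> that lies in the stabilizer.\<close>
  have iff: "\<one>\<^bsub>H\<^esub> \<in> u <#\<^bsub>H\<^esub> ?L \<longleftrightarrow> u \<in> ?L" if u: "u \<in> carrier H" for u
  proof
    assume "\<one>\<^bsub>H\<^esub> \<in> u <#\<^bsub>H\<^esub> ?L"
    then obtain l where l: "l \<in> ?L" "u \<otimes>\<^bsub>H\<^esub> l = \<one>\<^bsub>H\<^esub>" by (auto simp: l_coset_def)
    then have "u = inv\<^bsub>H\<^esub> l" using u H.inv_equality[of u l] by simp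
    then show "u \<in> ?L" using l by simp
  next
    assume "u \<in> ?L"
    then show "\<one>\<^bsub>H\<^esub> \<in> u <#\<^bsub>H\<^esub> ?L"
      unfolding l_coset_def using u by (intro UN_I[of "inv\<^bsub>H\<^esub> u"]) auto
  qed
  have u0L: "u0 \<in> ?L" using u0 UH iff by auto
  have eq: "x = \<phi> u x \<longleftrightarrow> u0 = u" if u: "u \<in> U" for u
  proof -
    have "\<phi> u x = x \<longleftrightarrow> u \<in> ?L" using u UH unfolding stabilizer_def by blast
    also have "\<dots> \<longleftrightarrow> u0 = u" using iff[of u] unique[OF u] u UH u0L by auto
    finally show ?thesis by metis
  qed
  have bp: "b p \<in> carrier R" using HomC_D(2)[OF b p] by simp
  \<comment> \<open>The representative u0 need not be the identity. It lies in the stabilizer, so b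
    is equivariant under its inverse, which acts trivially on R.\<close>
  have "b (gr_single R (inv\<^bsub>H\<^esub> u0) \<one>\<^bsub>R\<^esub> \<odot>\<^bsub>P n\<^esub> p) = b p"
    using HomC_D(4)[OF b L.m_inv_closed[OF u0L] R.one_closed p] bp u0(1) UH
    by (auto simp: trivial_module_act[OF R.is_cring finite_H])
  then have "(\<Oplus>\<^bsub>R\<^esub>u\<in>U. if x = \<phi> u x then b (gr_single R (inv\<^bsub>H\<^esub> u) \<one>\<^bsub>R\<^esub> \<odot>\<^bsub>P n\<^esub> p) else \<zero>\<^bsub>R\<^esub>) =
      (\<Oplus>\<^bsub>R\<^esub>u\<in>U. if u0 = u then b p else \<zero>\<^bsub>R\<^esub>)"
    using bp by (intro R.finsum_cong') (auto simp: eq)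
  also have "\<dots> = b p" using R.finsum_singleton[OF u0(1) finU, of "\<lambda>_. b p"] bp by simp
  finally show ?thesis using corestriction_gr_single[OF x x UH b p] by simp
qed

text \<open>By equivariance the coefficient of \<open>h y\<close> in \<open>f p\<close> is that of \<open>y\<close> in \<open>f (h\<inverse> p)\<close>.\<close>

lemma HomC_RG_eq_zero:
  assumes f: "f \<in> carrier (HomC (carrier H) RG n)"
    and cover: "\<And>x. x \<in> carrier G \<Longrightarrow> \<exists>y\<in>Y. \<exists>h\<in>carrier H. x = \<phi> h y" and Y: "Y \<subseteq> carrier G"
    and zero: "\<And>y p. \<lbrakk>y \<in> Y; p \<in> carrier (P n)\<rbrakk> \<Longrightarrow> f p y = \<zero>\<^bsub>R\<^esub>"
  shows "f = \<zero>\<^bsub>HomC (carrier H) RG n\<^esub>"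
proof (rule extensionalityI)
  interpret P: group_rep R H "P n" by (rule P_rep)
  fix p assume p: "p \<in> carrier (P n)"
  have fp: "f p \<in> carrier RG" by (rule HomC_D(2)[OF f p])
  have "f p x = \<zero>\<^bsub>R\<^esub>" for x
  proof (cases "x \<in> carrier G")
    case True
    then obtain y h where y: "y \<in> Y" and h: "h \<in> carrier H" and x: "x = \<phi> h y" using cover by blast
    have yG: "y \<in> carrier G" using y Y by auto
    have "f (gr_single R (inv\<^bsub>H\<^esub> h) \<one>\<^bsub>R\<^esub> \<odot>\<^bsub>P n\<^esub> p) y = f p x"
      using h p yG RG_closed[OF fp] by (simp add: HomC_D(4)[OF f] RG_act[OF _ _ fp] x)
    then show ?thesis using zero[OF y] h p by simp
  next
    case False
    then show ?thesis using fp by (simp add: carrier_RG)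
  qed
  then show "f p = \<zero>\<^bsub>HomC (carrier H) RG n\<^esub> p" using p by auto
qed (use HomC_D(1)[OF f] in auto)

end

text \<open>The map of the theorem and the map assembled from cochain maps are compared only on
  genuine cohomology classes. This lemma and the next transfer the isomorphism and its inverse along
  such an agreement.\<close>

lemma graded_iso_cong:
  assumes "graded_iso R M M' N N' f" and "\<And>x. x \<in> carrier M \<Longrightarrow> f' x = f x"
    and "\<And>n. M' n \<subseteq> carrier M"
  shows "graded_iso R M M' N N' f'"
proof -
  have M: "module R M" and f: "f \<in> lmod_hom R M N" and "bij_betw f (carrier M) (carrier N)"
    and "module R N" and im: "\<And>n. f ` M' n = N' n"
    using assms(1) by (auto simp: graded_iso_def)
  interpret module R M by (rule M)
  have "f' \<in> lmod_hom R M N" by (rule lmod_homI) (simp_all add: assms(2) lmod_homD[OF f])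
  moreover have "f' ` M' n = N' n" for n
    unfolding im[symmetric] using assms(2,3) by (intro image_cong) auto
  moreover have "bij_betw f' (carrier M) (carrier N)"
    using \<open>bij_betw f (carrier M) (carrier N)\<close> assms(2) by (simp cong: bij_betw_cong)
  ultimately show ?thesis using M \<open>module R N\<close> by (simp add: graded_iso_def)
qed

text \<open>The choice inside \<open>inv_into\<close> sees f only on \<open>A\<close>, so the
  predicates are equal and the equality holds even for y outside the image.\<close>

lemma inv_into_fun_cong:
  assumes "\<And>x. x \<in> A \<Longrightarrow> f x = f' x"
  shows "inv_into A f y = inv_into A f' y"
proof -
  have "(\<lambda>x. x \<in> A \<and> f x = y) = (\<lambda>x. x \<in> A \<and> f' x = y)" using assms by auto
  then show ?thesis by (simp add: inv_into_def)
qed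

theorem lemma5p3:
  fixes R :: "('r, 'e) ring_scheme" and G :: "('g, 'l) monoid_scheme" and H :: "('h, 'k) monoid_scheme"
    and \<phi> :: "'h \<Rightarrow> 'g \<Rightarrow> 'g" and g :: "nat \<Rightarrow> 'g" and t :: nat and U :: "nat \<Rightarrow> 'h set"
    and P :: "int \<Rightarrow> ('h \<Rightarrow> 'r, 'p) module" and d :: "int \<Rightarrow> 'p \<Rightarrow> 'p"
  assumes "group G" and "finite (carrier G)" and "group H" and "finite (carrier H)"
    and action: "group_hom H (AutoGroup G) \<phi>"
    and R: "(cring R \<and> R \<simeq> \<Z>) \<or>
      (field R \<and> (\<exists>p. ring_char R = p \<and> p > 0 \<and> p dvd order G))"
    and reps: "\<And>i. i \<in> {1..t} \<Longrightarrow> g i \<in> carrier G"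
      "bij_betw (\<lambda>i. orbit H \<phi> (g i)) {1..t} (orbits H (carrier G) \<phi>)"
    and cosets: "\<And>i. i \<in> {1..t} \<Longrightarrow> left_coset_reps H (stabilizer H \<phi> (g i)) (U i)"
    and P: "complete_resolution R H P d"
  shows "let RG = action_module R H G \<phi>;
      triv = trivial_module R H;
      Hi = (\<lambda>i. H\<lparr>carrier := stabilizer H \<phi> (g i)\<rparr>);
      \<Phi> = (\<lambda>\<zeta>. \<lambda>i\<in>{1..t}.
        tate_coeff_map R (Hi i) P d triv (gr_coeff (g i)) (tate_res R (Hi i) P d RG \<zeta>));
      S = direct_sum {1..t} (\<lambda>i. tate R (Hi i) P d triv);
      \<psi> = (\<lambda>i \<alpha>. tate_cor R H (U i) P d RG
        (tate_coeff_map R (Hi i) P d RG (gr_single R (g i)) \<alpha>))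
    in graded_iso R (tate R H P d RG) (tate_homogeneous R H P d RG)
         S (\<lambda>n. {x \<in> carrier S. \<forall>i\<in>{1..t}. x i \<in> tate_homogeneous R (Hi i) P d triv n}) \<Phi> \<and>
       (\<forall>i\<in>{1..t}. \<forall>\<alpha>\<in>carrier (tate R (Hi i) P d triv).
         inv_into (carrier (tate R H P d RG)) \<Phi>
           (\<lambda>j\<in>{1..t}. if j = i then \<alpha> else \<zero>\<^bsub>tate R (Hi j) P d triv\<^esub>) = \<psi> i \<alpha>)"
proof -
  \<comment> \<open>Either alternative for R yields a commutative ring, the structure on which the
    group ring computations rest.\<close>
  have R_cring: "cring R" using R by (auto simp: field_def domain_def)
  interpret permutation_complex R H G \<phi> P d
    by (intro permutation_complex.intro permutation_module.intro permutation_module_axioms.intro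
        group_action_of_automorphisms[OF action] rep_complex_complete_resolution R_cring assms(3,4) P)
  define L where "L i = stabilizer H \<phi> (g i)" for i
  \<comment> \<open>Restriction is the identity on cochains, so only the coefficient map remains
    visible in p.\<close>
  define p where "p i n f = compose (carrier (P n)) (gr_coeff (g i)) f" for i n and f :: "'p \<Rightarrow> 'g \<Rightarrow> 'r"
  define q where "q i n b = corestriction (U i) RG n (compose (carrier (P n)) (gr_single R (g i)) b)"
    for i n and b :: "'p \<Rightarrow> 'r"
  have L: "subgroup (L i) H" if "i \<in> {1..t}" for i
    unfolding L_def by (rule stabilizer_subgroup[OF reps(1)[OF that]])
  note res = restriction_cochain_map[OF group_rep_RG L]
  note coeff = coefficient_cochain_map[OF group_rep_RG group_rep_triv L,
      OF _ gr_coeff_hom[OF reps(1), folded L_def]]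
  note single = coefficient_cochain_map[OF group_rep_triv group_rep_RG L,
      OF _ gr_single_hom[OF reps(1), folded L_def]]
  note cor = corestriction_cochain_map[OF group_rep_RG L cosets[folded L_def]]
  have p: "cochain_map R (HomC (carrier H) RG) coboundary (HomC (L i) triv) coboundary (p i)"
    if "i \<in> {1..t}" for i
    using cochain_map_compose[OF res coeff, OF that that that] by (simp add: p_def[abs_def])
  have q: "cochain_map R (HomC (L i) triv) coboundary (HomC (carrier H) RG) coboundary (q i)"
    if "i \<in> {1..t}" for i
    using cochain_map_compose[OF single cor, OF that that that that] by (simp add: q_def[abs_def])
  have UH: "U i \<subseteq> carrier H" if "i \<in> {1..t}" for i
    using cosets[OF that] by (simp add: left_coset_reps_def)
  have pq: "p j n (q i n b) = (if j = i then b else \<zero>\<^bsub>HomC (L j) triv n\<^esub>)"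
    if i: "i \<in> {1..t}" and j: "j \<in> {1..t}" and b: "b \<in> carrier (HomC (L i) triv n)" for i j n b
  proof (rule extensionalityI[of _ "carrier (P n)"])
    fix x assume x: "x \<in> carrier (P n)"
    have px: "p j n (q i n b) x = q i n b x (g j)" using x by (simp add: p_def compose_eq gr_coeff_def)
    show "p j n (q i n b) x = (if j = i then b else \<zero>\<^bsub>HomC (L j) triv n\<^esub>) x"
    proof (cases "j = i")
      case True
      then show ?thesis
        using corestriction_gr_single_same[OF reps(1)[OF i] cosets[OF i] b[unfolded L_def] x] px
        unfolding True q_def by simp
    next
      case False
      \<comment> \<open>Orbits that meet are equal, and distinct indices have distinct orbits
        because \<open>reps\<close> is injective on indices.\<close>
      have "g j \<notin> orbit H \<phi> (g i)"
      proof
        assume gj: "g j \<in> orbit H \<phi> (g i)"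
        have "orbit H \<phi> (g i) \<in> orbits H (carrier G) \<phi>" "orbit H \<phi> (g j) \<in> orbits H (carrier G) \<phi>"
          using reps(1)[OF i] reps(1)[OF j] by (auto simp: orbits_def)
        then have "orbit H \<phi> (g i) = orbit H \<phi> (g j)"
          using action.disjoint_union[of "orbit H \<phi> (g i)" "orbit H \<phi> (g j)"]
            gj action.orbit_refl[OF reps(1)[OF j]] by blast
        then show False using inj_onD[OF bij_betw_imp_inj_on[OF reps(2)] _ i j] False by blast
      qed
      then show ?thesis
        using corestriction_gr_single_other_orbit[OF reps(1)[OF i] reps(1)[OF j] UH[OF i] b[unfolded L_def] x]
          False x by (simp add: px[unfolded q_def] q_def)
    qed
  qed (use HomC_D(1)[OF b] in \<open>auto simp: p_def\<close>)
  have inj: "f = \<zero>\<^bsub>HomC (carrier H) RG n\<^esub>" if f: "f \<in> carrier (HomC (carrier H) RG n)"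
    and 0: "\<And>i. i \<in> {1..t} \<Longrightarrow> p i n f = \<zero>\<^bsub>HomC (L i) triv n\<^esub>" for f n
  proof (rule HomC_RG_eq_zero[OF f, where Y = "g ` {1..t}"])
    \<comment> \<open>The orbits of the representatives exhaust all orbits, so every x is a
      translate of some \<open>g i\<close>.\<close>
    show "\<exists>y\<in>g ` {1..t}. \<exists>h\<in>carrier H. x = \<phi> h y" if x: "x \<in> carrier G" for x
    proof -
      have "orbit H \<phi> x \<in> (\<lambda>i. orbit H \<phi> (g i)) ` {1..t}"
        using bij_betw_imp_surj_on[OF reps(2)] x by (auto simp: orbits_def)
      then obtain i where i: "i \<in> {1..t}" "orbit H \<phi> x = orbit H \<phi> (g i)" by blast
      then have "x \<in> orbit H \<phi> (g i)" using action.orbit_refl[OF x] by simp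
      then show ?thesis using i(1) by (auto simp: orbit_def)
    qed
    fix y x assume "y \<in> g ` {1..t}" and x: "x \<in> carrier (P n)"
    then obtain i where i: "i \<in> {1..t}" "y = g i" by blast
    have "p i n f x = \<zero>\<^bsub>HomC (L i) triv n\<^esub> x" by (simp only: 0[OF i(1)])
    then show "f x y = \<zero>\<^bsub>R\<^esub>" using x i(2) by (simp add: p_def compose_eq gr_coeff_def)
  qed (use reps(1) in auto)
  \<comment> \<open>It turns the uniform notation for cochains over the full group back into the one
    of the statement.\<close>
  have H_carrier: "H\<lparr>carrier := carrier H\<rparr> = H" by simp
  let ?Hi = "\<lambda>i. H\<lparr>carrier := L i\<rparr>"
  let ?\<Phi>' = "\<lambda>\<zeta>. \<lambda>i\<in>{1..t}. \<lambda>n. cohomology_map (HomC (L i) triv) coboundary (p i) n (\<zeta> n)"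
  let ?\<Phi> = "\<lambda>\<zeta>. \<lambda>i\<in>{1..t}.
    tate_coeff_map R (?Hi i) P d triv (gr_coeff (g i)) (tate_res R (?Hi i) P d RG \<zeta>)"
  let ?\<psi> = "\<lambda>i \<alpha>. tate_cor R H (U i) P d RG (tate_coeff_map R (?Hi i) P d RG (gr_single R (g i)) \<alpha>)"
  let ?S = "direct_sum {1..t} (\<lambda>i. tate R (?Hi i) P d triv)"
  have tate_carrier: "\<zeta> n \<in> carrier (cohomology (\<lambda>n. hom_module R K (P n) N) coboundary n)"
    if "\<zeta> \<in> carrier (tate R K P d N)" for K \<zeta> n and N :: "('h \<Rightarrow> 'r, 'n) module"
    using that by (simp add: tate_def carrier_direct_sum tate_degree_eq_cohomology)
  \<comment> \<open>Two successive induced maps merge into one only on classes of cocycles, which is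
    why the equality is restricted to the carrier; the same holds for the equality for \<psi>
    below.\<close>
  have \<Phi>_eq: "?\<Phi> \<zeta> = ?\<Phi>' \<zeta>" if \<zeta>: "\<zeta> \<in> carrier (tate R H P d RG)" for \<zeta>
  proof (intro restrict_ext ext)
    fix i n assume i: "i \<in> {1..t}"
    show "tate_coeff_map R (?Hi i) P d triv (gr_coeff (g i)) (tate_res R (?Hi i) P d RG \<zeta>) n =
        cohomology_map (HomC (L i) triv) coboundary (p i) n (\<zeta> n)"
      using cohomology_map_compose[OF res coeff, OF i i i, unfolded H_carrier, OF tate_carrier[OF \<zeta>], of n]
      by (simp add: tate_coeff_map_def tate_res_def tate_map_eq_cohomology_map p_def[abs_def])
  qed
  have \<psi>_eq: "?\<psi> i \<alpha> = (\<lambda>n. cohomology_map (HomC (carrier H) RG) coboundary (q i) n (\<alpha> n))"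
    if i: "i \<in> {1..t}" and \<alpha>: "\<alpha> \<in> carrier (tate R (?Hi i) P d triv)" for i \<alpha>
  proof
    fix n
    show "?\<psi> i \<alpha> n = cohomology_map (HomC (carrier H) RG) coboundary (q i) n (\<alpha> n)"
      using cohomology_map_compose[OF single cor, OF i i i i, OF tate_carrier[OF \<alpha>], of n]
      by (simp add: tate_coeff_map_def tate_cor_def tate_map_eq_cohomology_map q_def[abs_def]
          corestriction_def[abs_def])
  qed
  \<comment> \<open>The abstract theorem is instantiated at these complexes, and its cohomology
    groups are folded back into \<open>tate\<close> and \<open>tate_homogeneous\<close>.\<close>
  note iso = cohomology_graded_iso_direct_sum[of "{1..t}" R "HomC (carrier H) RG" coboundary
      "\<lambda>i. HomC (L i) triv" "\<lambda>_. coboundary" p q, OF finite_atLeastAtMost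
      HomC_complex[OF group_rep_RG H.subgroup_self] p q pq inj, unfolded H_carrier,
      folded tate_degree_eq_cohomology, folded tate_def, folded tate_homogeneous_def]
  have "graded_iso R (tate R H P d RG) (tate_homogeneous R H P d RG) ?S
      (\<lambda>n. {x \<in> carrier ?S. \<forall>i\<in>{1..t}. x i \<in> tate_homogeneous R (?Hi i) P d triv n}) ?\<Phi>"
    by (rule graded_iso_cong[OF iso(1) \<Phi>_eq]) (auto simp: tate_homogeneous_def)
  moreover have "inv_into (carrier (tate R H P d RG)) ?\<Phi>
      (\<lambda>j\<in>{1..t}. if j = i then \<alpha> else \<zero>\<^bsub>tate R (?Hi j) P d triv\<^esub>) = ?\<psi> i \<alpha>"
    if i: "i \<in> {1..t}" and \<alpha>: "\<alpha> \<in> carrier (tate R (?Hi i) P d triv)" for i \<alpha>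
  proof -
    have \<Phi>': "inv_into (carrier (tate R H P d RG)) ?\<Phi> y = inv_into (carrier (tate R H P d RG)) ?\<Phi>' y" for y
      by (rule inv_into_fun_cong[OF \<Phi>_eq])
    show ?thesis
      unfolding \<Phi>' \<psi>_eq[OF i \<alpha>] unfolding H_carrier by (rule iso(2)) (use i \<alpha> in auto)
  qed
  ultimately show ?thesis unfolding Let_def L_def by blast
qed

end
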